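(* Let $R, S, \iota, G$ satisfy the standing assumptions (A1)–(A4) listed in the context, and let $p,m$ be positive integers. If $P_0,P_1\in\mathbb{S}(R,p,m)$ and $C\in\mathbb{S}(R,m,p)$, then $$\sin^{-1}\mu_{P_1,C}\ \ge\ \sin^{-1}\mu_{P_0,C}-\sin^{-1}\big(d_\nu(P_0,P_1)\big).$$
   Context: Standing assumptions. (A1) $R$ is a commutative integral domain with identity. (A2) $S$ is a unital commutative complex semisimple Banach algebra with an involution $\cdot^*$, such that $R\subset S$. $\mathrm{inv}\,S$ denotes the set of invertible elements of $S$. (A3) There is a map $\iota:\mathrm{inv}\,S\to G$, where $(G,+)$ is an Abelian group with identity $\circ$, such that: (I1) $\iota(ab)=\iota(a)+\iota(b)$ for $a,b\in \mathrm{inv}\,S$; (I2) $\iota(a^* )=-\iota(a)$ for $a\in\mathrm{inv}\,S$; (I3) $\iota$ is locally constant, i.e. continuous when $G$ has the discrete topology. (A4) An element $x\in R\cap \mathrm{inv}\,S$ is invertible as an element of $R$ if and only if $\iota(x)=\circ$. Notation. $\mathbb{F}(R)$ is the field of fractions of $R$. For a matrix $F$ with entries in $R$, $F^*$ is the matrix over $S$ with $(i,j)$ entry $(F_{ji})^*$. For $P\in \mathbb{F}(R)^{p\times m}$, a factorization $P=ND^{-1}$ with $N,D$ matrices over $R$ is a right coprime factorization if there are matrices $X,Y$ over $R$ with $XN+YD=I_m$; it is normalized if moreover $N^*N+D^*D=I_m$. A factorization $P=\widetilde D^{-1}\widetilde N$ with $\widetilde N,\widetilde D$ matrices over $R$ is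 a left coprime factorization if there are matrices $\widetilde X,\widetilde Y$ over $R$ with $\widetilde N\widetilde X+\widetilde D\widetilde Y=I_p$; it is normalized if moreover $\widetilde N\widetilde N^*+\widetilde D\widetilde D^*=I_p$. $\mathbb{S}(R,p,m)$ is the set of all $P\in\mathbb{F}(R)^{p\times m}$ possessing both a normalized right and a normalized left coprime factorization ($\mathbb S(R,m,p)$ is the same with the roles of $p,m$ exchanged). For $P_i\in\mathbb S(R,p,m)$ with normalized factorizations $P_i=N_iD_i^{-1}=\widetilde D_i^{-1}\widetilde N_i$, put $G_i=\begin{bmatrix}N_i\\ D_i\end{bmatrix}$ and $\widetilde G_i=\begin{bmatrix}-\widetilde D_i&\widetilde N_i\end{bmatrix}$. $\mathfrak M$ is the maximal ideal space of $S$. For a matrix $M$ over $S$, $\mathbf{M}$ denotes its entrywise Gelfand transform and $\|M\|_\infty=\max_{\varphi\in\mathfrak M}\|\mathbf M(\varphi)\|$, where $\|\cdot\|$ is the operator norm induced by Euclidean norms. Definition of $d_\nu$: for $P_1,P_2\in\mathbb{S}(R,p,m)$ with normalized left/right coprime factorizations and the associated $G_1,\widetilde G_1,G_2,\widetilde G_2$, $d_\nu(P_1,P_2)=\|\widetilde G_2G_1\|_\infty$ if $\det(G_1^*G_2)\in\mathrm{inv}\,S$ and $\iota(\det(G_1^*G_2))=\circ$, and $d_\nu(P_1,P_2)=1$ otherwise. Stability margin: for $P\in\mathbb{F}(R)^{p\times m}$ and $C\in\mathbb{F}(R)^{m\times p}$, set $H(P,C)=\begin{bmatrix}P\\ I\end{bmatrix}(I-CP)^{-1}\begin{bmatrix}-C&I\end{bmatrix}$.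 $C$ stabilizes $P$ if $I-CP$ is invertible over $\mathbb{F}(R)$ and $H(P,C)\in R^{(p+m)\times(p+m)}$. Define $\mu_{P,C}=\|H(P,C)\|_\infty^{-1}$ if $C$ stabilizes $P$, and $\mu_{P,C}=0$ otherwise. $\sin^{-1}$ is the inverse sine $[-1,1]\to[-\pi/2,\pi/2]$.
   Formalization: The involution on S is additionally assumed symmetric: the Gelfand transform of x* is the complex conjugate of that of x; for a general involution d_ν need not be well defined and the inequality can fail. *)

theory Defs
  imports "HOL-Analysis.Analysis" "HOL-Computational_Algebra.Polynomial_Factorial"
begin

text \<open>Unital commutative complex Banach algebras. The real structure of the library classes
  is the restriction of the complex one.\<close>

class comm_complex_banach_algebra_1 = comm_ring_1 + real_normed_algebra_1 + banach +
  fixes scaleC :: "complex \<Rightarrow> 'a \<Rightarrow> 'a"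
  assumes scaleC_add_right: "scaleC c (x + y) = scaleC c x + scaleC c y"
    and scaleC_add_left: "scaleC (c + d) x = scaleC c x + scaleC d x"
    and scaleC_scaleC: "scaleC c (scaleC d x) = scaleC (c * d) x"
    and scaleC_of_real: "scaleC (complex_of_real r) x = r *\<^sub>R x"
    and mult_scaleC_left: "scaleC c x * y = scaleC c (x * y)"
    and norm_scaleC: "norm (scaleC c x) = cmod c * norm x"

text \<open>A subspace of a ring, regarded as a module over itself, is an ideal.\<close>

definition maximal_ideal :: "'a::comm_ring_1 set \<Rightarrow> bool" where
  "maximal_ideal I \<longleftrightarrow> module.subspace (*) I \<and> I \<noteq> UNIV \<and>
     (\<forall>J. module.subspace (*) J \<and> I \<subseteq> J \<longrightarrow> J = I \<or> J = UNIV)"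

text \<open>Semisimplicity of a commutative Banach algebra says that this set is \<open>{0}\<close>.\<close>

definition jacobson_radical :: "'a::comm_ring_1 set" where
  "jacobson_radical = \<Inter> {I. maximal_ideal I}"

text \<open>As usual, the points of the maximal ideal space are the (nonzero) complex homomorphisms;
  the Gelfand transform of \<open>x\<close> is \<open>\<lambda>\<phi>. \<phi> x\<close>.\<close>

definition maximal_ideal_space :: "('s::comm_complex_banach_algebra_1 \<Rightarrow> complex) set" where
  "maximal_ideal_space =
     {\<phi>. (\<forall>x y. \<phi> (x + y) = \<phi> x + \<phi> y) \<and> (\<forall>c x. \<phi> (scaleC c x) = c * \<phi> x) \<and>
         (\<forall>x y. \<phi> (x * y) = \<phi> x * \<phi> y) \<and> \<phi> 1 = 1}"

definition involution :: "('s::comm_complex_banach_algebra_1 \<Rightarrow> 's) \<Rightarrow> bool" where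
  "involution star \<longleftrightarrow>
     (\<forall>x y. star (x + y) = star x + star y) \<and> (\<forall>c x. star (scaleC c x) = scaleC (cnj c) (star x)) \<and>
     (\<forall>x y. star (x * y) = star y * star x) \<and> (\<forall>x. star (star x) = x)"

text \<open>Under the Gelfand transform, the involution becomes complex conjugation. An involution of a
  semisimple commutative Banach algebra need not have this property (swap the two coordinates of
  \<open>\<complex> \<times> \<complex>\<close> and conjugate), but without it the \<open>\<nu>\<close>-metric below may depend on the chosen
  factorizations and exceed 1.\<close>

definition symmetric_involution :: "('s::comm_complex_banach_algebra_1 \<Rightarrow> 's) \<Rightarrow> bool" where
  "symmetric_involution star \<longleftrightarrow>
     involution star \<and> (\<forall>\<phi> \<in> maximal_ideal_space. \<forall>x. \<phi> (star x) = cnj (\<phi> x))"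

text \<open>The group is discrete, so continuity of \<open>\<iota>\<close> on the invertible elements is local constancy.\<close>

definition abstract_index :: "('s::comm_complex_banach_algebra_1 \<Rightarrow> 's) \<Rightarrow> ('s \<Rightarrow> 'g::ab_group_add) \<Rightarrow> bool" where
  "abstract_index star \<iota> \<longleftrightarrow>
     (\<forall>a b. a dvd 1 \<and> b dvd 1 \<longrightarrow> \<iota> (a * b) = \<iota> a + \<iota> b) \<and>
     (\<forall>a. a dvd 1 \<longrightarrow> \<iota> (star a) = - \<iota> a) \<and>
     continuous_map (top_of_set {a. a dvd 1}) (discrete_topology UNIV) \<iota>"

text \<open>The inclusion of \<open>R\<close> in \<open>S\<close> is an injective unital ring homomorphism \<open>emb\<close>.\<close>

definition ring_embedding :: "('r::comm_ring_1 \<Rightarrow> 's::comm_ring_1) \<Rightarrow> bool" where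
  "ring_embedding emb \<longleftrightarrow> inj emb \<and> emb 1 = 1 \<and>
     (\<forall>x y. emb (x + y) = emb x + emb y) \<and> (\<forall>x y. emb (x * y) = emb x * emb y)"

definition mat_star :: "('s \<Rightarrow> 's) \<Rightarrow> 's^'n^'k \<Rightarrow> 's^'k^'n" where
  "mat_star star A = (\<chi> i j. star (A $ j $ i))"

definition vcat :: "'a^'n^'k \<Rightarrow> 'a^'n^'l \<Rightarrow> 'a^'n^('k + 'l)" where
  "vcat A B = (\<chi> i j. case i of Inl k \<Rightarrow> A $ k $ j | Inr l \<Rightarrow> B $ l $ j)"

definition hcat :: "'a^'k^'n \<Rightarrow> 'a^'l^'n \<Rightarrow> 'a^('k + 'l)^'n" where
  "hcat A B = (\<chi> i j. case j of Inl k \<Rightarrow> A $ i $ k | Inr l \<Rightarrow> B $ i $ l)"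

text \<open>The operator norms depend continuously on the point of the compact maximal ideal space, so
  this supremum is a maximum.\<close>

definition gelfand_norm :: "'s::comm_complex_banach_algebra_1^'n^'k \<Rightarrow> real" where
  "gelfand_norm A = (SUP \<phi> \<in> maximal_ideal_space. onorm (\<lambda>v. map_matrix \<phi> A *v v))"

definition right_coprime_factorization ::
    "'r::idom fract^'m^'p \<Rightarrow> 'r^'m^'p \<Rightarrow> 'r^'m^'m \<Rightarrow> bool" where
  "right_coprime_factorization P N D \<longleftrightarrow>
     invertible (map_matrix to_fract D) \<and>
     P = map_matrix to_fract N ** matrix_inv (map_matrix to_fract D) \<and>
     (\<exists>X Y. X ** N + Y ** D = mat 1)"

definition left_coprime_factorization ::
    "'r::idom fract^'m^'p \<Rightarrow> 'r^'m^'p \<Rightarrow> 'r^'p^'p \<Rightarrow> bool" where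
  "left_coprime_factorization P N D \<longleftrightarrow>
     invertible (map_matrix to_fract D) \<and>
     P = matrix_inv (map_matrix to_fract D) ** map_matrix to_fract N \<and>
     (\<exists>X Y. N ** X + D ** Y = mat 1)"

definition normalized_rcf ::
    "('r::idom \<Rightarrow> 's::comm_complex_banach_algebra_1) \<Rightarrow> ('s \<Rightarrow> 's) \<Rightarrow>
     'r fract^'m^'p \<Rightarrow> 'r^'m^'p \<Rightarrow> 'r^'m^'m \<Rightarrow> bool" where
  "normalized_rcf emb star P N D \<longleftrightarrow> right_coprime_factorization P N D \<and>
     mat_star star (map_matrix emb N) ** map_matrix emb N +
     mat_star star (map_matrix emb D) ** map_matrix emb D = mat 1"

definition normalized_lcf ::
    "('r::idom \<Rightarrow> 's::comm_complex_banach_algebra_1) \<Rightarrow> ('s \<Rightarrow> 's) \<Rightarrow>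
     'r fract^'m^'p \<Rightarrow> 'r^'m^'p \<Rightarrow> 'r^'p^'p \<Rightarrow> bool" where
  "normalized_lcf emb star P N D \<longleftrightarrow> left_coprime_factorization P N D \<and>
     map_matrix emb N ** mat_star star (map_matrix emb N) +
     map_matrix emb D ** mat_star star (map_matrix emb D) = mat 1"

definition normalized_plants ::
    "('r::idom \<Rightarrow> 's::comm_complex_banach_algebra_1) \<Rightarrow> ('s \<Rightarrow> 's) \<Rightarrow> ('r fract^'m^'p) set" where
  "normalized_plants emb star =
     {P. (\<exists>N D. normalized_rcf emb star P N D) \<and> (\<exists>N D. normalized_lcf emb star P N D)}"

definition d_nu_value ::
    "('s::comm_complex_banach_algebra_1 \<Rightarrow> 's) \<Rightarrow> ('s \<Rightarrow> 'g::ab_group_add) \<Rightarrow>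
     's^'m^('p + 'm) \<Rightarrow> 's^'m^('p + 'm) \<Rightarrow> 's^('p + 'm)^'p \<Rightarrow> real" where
  "d_nu_value star \<iota> G1 G2 Gt2 =
     (if det (mat_star star G1 ** G2) dvd 1 \<and> \<iota> (det (mat_star star G1 ** G2)) = 0
      then gelfand_norm (Gt2 ** G1) else 1)"

text \<open>The description operator expresses that the value does not depend on the choice of the
  normalized factorizations.\<close>

definition d_nu ::
    "('r::idom \<Rightarrow> 's::comm_complex_banach_algebra_1) \<Rightarrow> ('s \<Rightarrow> 's) \<Rightarrow> ('s \<Rightarrow> 'g::ab_group_add) \<Rightarrow>
     'r fract^'m^'p \<Rightarrow> 'r fract^'m^'p \<Rightarrow> real" where
  "d_nu emb star \<iota> P1 P2 =
     (THE d. \<exists>N1 D1 N2 D2 Nt2 Dt2.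
        normalized_rcf emb star P1 N1 D1 \<and> normalized_rcf emb star P2 N2 D2 \<and>
        normalized_lcf emb star P2 Nt2 Dt2 \<and>
        d = d_nu_value star \<iota> (map_matrix emb (vcat N1 D1)) (map_matrix emb (vcat N2 D2))
              (map_matrix emb (hcat (- Dt2) Nt2)))"

definition closed_loop :: "'f::field^'m^'p \<Rightarrow> 'f^'p^'m \<Rightarrow> 'f^('p + 'm)^('p + 'm)" where
  "closed_loop P C = vcat P (mat 1) ** matrix_inv (mat 1 - C ** P) ** hcat (- C) (mat 1)"

definition stabilizes :: "'r::idom fract^'p^'m \<Rightarrow> 'r fract^'m^'p \<Rightarrow> bool" where
  "stabilizes C P \<longleftrightarrow> invertible (mat 1 - C ** P) \<and> (\<exists>H. map_matrix to_fract H = closed_loop P C)"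

text \<open>For the norm, \<open>H(P,C)\<close> has to be read as a matrix over \<open>R\<close>, and then over \<open>S\<close>.\<close>

definition stability_margin ::
    "('r::idom \<Rightarrow> 's::comm_complex_banach_algebra_1) \<Rightarrow> 'r fract^'m^'p \<Rightarrow> 'r fract^'p^'m \<Rightarrow> real" where
  "stability_margin emb P C =
     (if stabilizes C P
      then inverse (gelfand_norm (map_matrix emb (THE H. map_matrix to_fract H = closed_loop P C)))
      else 0)"

end

theory Submission
  imports Defs
begin

text \<open>Let \<open>K = [-N\<^sub>c D\<^sub>c]\<close> come from the left factorization of \<open>C\<close>. Then \<open>C\<close> stabilizes \<open>P\<^sub>i\<close> iff
  \<open>K G\<^sub>i\<close> is invertible over \<open>R\<close>, in which case \<open>H(P\<^sub>i, C) = G\<^sub>i (K G\<^sub>i)\<^sup>-\<^sup>1 K\<close>, and the margin is the least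
  singular value of \<open>K G\<^sub>i\<close> over all characters, that is the sine of the least angle between the range of
  \<open>G\<^sub>i\<close> and the kernel of \<open>K\<close>. The \<open>\<nu>\<close>-metric is the sine of the largest angle between the ranges of
  \<open>G\<^sub>0\<close> and \<open>G\<^sub>1\<close>, so at every character the estimate is the triangle inequality for angles. That
  \<open>K G\<^sub>1\<close> is invertible over \<open>R\<close> and not only over \<open>S\<close> follows from the index: the segment from \<open>K G\<^sub>0\<close> to
  \<open>(K G\<^sub>1) (G\<^sub>1\<^sup>* G\<^sub>0)\<close> consists of invertible matrices when the distance of the plants is below the
  margin. Invertibility over \<open>S\<close> is tested on characters by Gelfand theory, where the Gelfand-Mazur theorem is
  proved without functionals, from a maximum principle for the norm of the resolvent.\<close>

subsection \<open>Complex homomorphisms of commutative Banach algebras\<close>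

lemma mult_scaleC_right: "x * scaleC c y = scaleC c (x * y :: 's::comm_complex_banach_algebra_1)"
  by (metis mult.commute mult_scaleC_left)

lemma scaleC_one [simp]: "scaleC 1 x = (x :: 's::comm_complex_banach_algebra_1)"
  using scaleC_of_real[of 1 x] by simp

lemma scaleC_zero [simp]: "scaleC 0 x = (0 :: 's::comm_complex_banach_algebra_1)"
  using scaleC_of_real[of 0 x] by simp

lemma scaleC_minus_one: "scaleC (-1) x = - (x :: 's::comm_complex_banach_algebra_1)"
  using scaleC_of_real[of "-1" x] by simp

lemma scaleC_zero_right [simp]: "scaleC c 0 = (0 :: 's::comm_complex_banach_algebra_1)"
  using scaleC_add_right[of c 0 0] by simp

lemma scaleC_minus_right: "scaleC c (- x) = - scaleC c (x :: 's::comm_complex_banach_algebra_1)"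
  using scaleC_add_right[of c "-x" x] by (simp add: eq_neg_iff_add_eq_0)

lemma scaleC_diff_right:
  "scaleC c (x - y) = scaleC c x - scaleC c (y :: 's::comm_complex_banach_algebra_1)"
  using scaleC_add_right[of c x "-y"] by (simp add: scaleC_minus_right)

lemma scaleC_diff_left:
  "scaleC (c - d) x = scaleC c x - scaleC d (x :: 's::comm_complex_banach_algebra_1)"
  using scaleC_add_left[of "c - d" d x] by (simp add: algebra_simps)

lemma scaleC_one_power: "scaleC c 1 ^ n = scaleC (c ^ n) (1 :: 's::comm_complex_banach_algebra_1)"
  by (induction n) (simp_all add: mult_scaleC_left scaleC_scaleC)

lemma scaleC_sum_left:
  "scaleC (\<Sum>k\<in>A. f k) (x :: 's::comm_complex_banach_algebra_1) = (\<Sum>k\<in>A. scaleC (f k) x)"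
  by (induction A rule: infinite_finite_induct) (simp_all add: scaleC_add_left)

lemma scaleC_of_nat: "scaleC (of_nat n) x = of_nat n * (x :: 's::comm_complex_banach_algebra_1)"
  by (induction n) (simp_all add: scaleC_add_left algebra_simps)

text \<open>The Neumann series in \<open>1 - x\<close> sums to an inverse of
  \<open>x\<close>.\<close>

lemma norm_one_minus_less_one_imp_unit:
  fixes x :: "'s::{real_normed_algebra_1, banach, comm_ring_1}"
  assumes "norm (1 - x) < 1"
  shows "x dvd 1"
proof -
  define y where "y = 1 - x"
  have s: "summable (\<lambda>n. y ^ n)"
    using assms by (intro complete_algebra_summable_geometric) (simp add: y_def)
  have "(\<Sum>n. y ^ n) = 1 + (\<Sum>n. y ^ Suc n)"
    using suminf_split_head[OF s] by simp
  also have "(\<Sum>n. y ^ Suc n) = y * (\<Sum>n. y ^ n)"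
    using suminf_mult[OF s, of y] by simp
  finally have "1 = x * (\<Sum>n. y ^ n)"
    by (simp add: y_def algebra_simps)
  then show ?thesis by (rule dvdI)
qed

text \<open>Since \<open>n\<close> does not divide \<open>j\<close>, the \<open>j\<close>-th power
  of the primitive root is an \<open>n\<close>-th root of unity other than 1, and the geometric sum
  over its powers vanishes.\<close>

lemma sum_powers_root_of_unity:
  assumes "0 < j" "j < n"
  shows "(\<Sum>k<n. (cis (2 * pi / n) ^ k) ^ j) = 0"
proof -
  define z where "z = cis (2 * pi / n) ^ j"
  have z: "z = exp (2 * of_real pi * \<i> * of_nat j / of_nat n)"
    unfolding z_def Complex.DeMoivre unfolding cis_conv_exp by (intro arg_cong[of _ _ exp]) (simp add: field_simps)
  have "z \<noteq> 1"
    using complex_root_unity_eq_1[of n j] assms unfolding z by (auto dest: dvd_imp_le)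
  moreover have "z ^ n = 1"
    using complex_root_unity[of n j] assms unfolding z by simp
  moreover have "(\<Sum>k<n. (cis (2 * pi / n) ^ k) ^ j) = (\<Sum>k<n. z ^ k)"
    by (simp add: z_def power_mult[symmetric] mult.commute)
  ultimately show ?thesis by (simp add: geometric_sum)
qed

text \<open>Replaces the norm of a quotient algebra without forming the quotient:
  \<open>q x = 0\<close> is read as \<open>x = 0\<close> in the quotient, so identities are proved
  only up to null elements.\<close>

locale submultiplicative_seminorm =
  fixes q :: "'s::comm_complex_banach_algebra_1 \<Rightarrow> real"
  assumes add_le: "q (x + y) \<le> q x + q y"
    and mult_le: "q (x * y) \<le> q x * q y"
    and scaleC: "q (scaleC c x) = cmod c * q x"
    and one: "q 1 = 1"
begin

lemma zero: "q 0 = 0"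
  using scaleC[of 0 0] by simp

lemma minus: "q (- x) = q x"
  using scaleC[of "-1" x] by (simp add: scaleC_minus_one)

lemma diff_le: "q (x - y) \<le> q x + q y"
  using add_le[of x "- y"] by (simp add: minus)

lemma nonneg: "0 \<le> q x"
  using diff_le[of x x] by (simp add: zero)

lemma sum_le: "q (\<Sum>k\<in>A. f k) \<le> (\<Sum>k\<in>A. q (f k))"
  by (induction A rule: infinite_finite_induct) (auto simp: zero intro: order_trans[OF add_le])

lemma null_add: "q x = 0 \<Longrightarrow> q y = 0 \<Longrightarrow> q (x + y) = 0"
  using add_le[of x y] nonneg[of "x + y"] by simp

lemma null_minus: "q x = 0 \<Longrightarrow> q (- x) = 0"
  by (simp add: minus)

lemma null_mult: "q x = 0 \<Longrightarrow> q (x * y) = 0" "q x = 0 \<Longrightarrow> q (y * x) = 0"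
  using mult_le[of x y] mult_le[of y x] nonneg[of "x * y"] by (simp_all add: mult.commute)

lemma null_sum: "(\<And>k. k \<in> A \<Longrightarrow> q (f k) = 0) \<Longrightarrow> q (\<Sum>k\<in>A. f k) = 0"
  by (induction A rule: infinite_finite_induct) (auto simp: zero null_add)

lemma cong: "q (x - y) = 0 \<Longrightarrow> q x = q y"
  using add_le[of "x - y" y] diff_le[of x "x - y"] by simp

text \<open>The resolvent at the center of a circle is nearly the mean of its values at the vertices
  of an inscribed regular \<open>n\<close>-gon, because \<open>\<Sum>\<^sub>k (b - \<omega>\<^sub>k)\<^sup>-\<^sup>1 = n b\<^bsup>n-1\<^esup> (b\<^sup>n - h\<^sup>n)\<^sup>-\<^sup>1\<close>
  for \<open>\<omega>\<^sub>k\<^sup>n = h\<^sup>n\<close>.\<close>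

lemma resolvent_mean_value:
  assumes R: "\<And>c. q ((a - scaleC c 1) * R c - 1) = 0"
    and n: "n > 0" and M: "\<And>c. q (R c) \<le> M" and w: "q (R w) = M"
  shows "M - q (R (w + h)) \<le> M * (n * (cmod h * M) ^ n)"
proof -
  define b where "b = a - scaleC w 1"
  define B where "B = R w"
  define \<omega> where "\<omega> k = h * cis (2 * pi / n) ^ k" for k
  define T where "T k = R (w + \<omega> k)" for k
  \<comment> \<open>\<open>E k\<close> is the cofactor of \<open>b - \<omega> k\<close> in
    \<open>b ^ n - h ^ n\<close>; it clears all resolvents to one common denominator.\<close>
  define E where "E k = (\<Sum>i<n. b ^ (n - Suc i) * scaleC (\<omega> k) 1 ^ i)" for k
  have bB: "q (b * B - 1) = 0" using R[of w] by (simp add: b_def B_def)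
  have T: "q ((b - scaleC (\<omega> k) 1) * T k - 1) = 0" for k
    using R[of "w + \<omega> k"] by (simp add: b_def T_def scaleC_add_left algebra_simps)
  have "\<omega> k ^ n = h ^ n * (cis (2 * pi / n) ^ n) ^ k" for k
    by (simp add: \<omega>_def power_mult_distrib power_mult[symmetric] mult.commute)
  moreover have "cis (2 * pi / n) ^ n = 1"
  proof -
    have "real n * (2 * pi / n) = 2 * pi" using n by simp
    then show ?thesis unfolding Complex.DeMoivre by simp
  qed
  ultimately have \<omega>n: "\<omega> k ^ n = h ^ n" for k
    by simp
  have E: "(b - scaleC (\<omega> k) 1) * E k = b ^ n - scaleC (h ^ n) 1" for k
  proof -
    have "scaleC (\<omega> k) 1 ^ n - b ^ n = (scaleC (\<omega> k) 1 - b) * E k"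
      unfolding E_def by (rule power_diff_sumr2)
    then show ?thesis by (simp add: scaleC_one_power \<omega>n algebra_simps)
  qed
  \<comment> \<open>Averaging over the vertices kills every power below \<open>n\<close> except the
    zeroth, so only the leading term of \<open>E k\<close> survives the summation.\<close>
  have sum_\<omega>: "(\<Sum>k<n. \<omega> k ^ i) = (if i = 0 then of_nat n else 0)" if "i < n" for i
    using that sum_powers_root_of_unity[of i n]
    by (auto simp: \<omega>_def power_mult_distrib sum_distrib_left[symmetric])
  have sum_E: "(\<Sum>k<n. E k) = of_nat n * b ^ (n - 1)"
  proof -
    have "(\<Sum>k<n. E k) = (\<Sum>i<n. \<Sum>k<n. b ^ (n - Suc i) * scaleC (\<omega> k) 1 ^ i)"
      unfolding E_def by (rule sum.swap)
    also have "\<dots> = (\<Sum>i<n. b ^ (n - Suc i) * scaleC (\<Sum>k<n. \<omega> k ^ i) 1)"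
      by (simp add: scaleC_one_power scaleC_sum_left sum_distrib_left)
    also have "\<dots> = (\<Sum>i<n. if i = 0 then b ^ (n - 1) * scaleC (of_nat n) 1 else 0)"
      by (intro sum.cong refl) (auto simp: sum_\<omega>)
    also have "\<dots> = b ^ (n - 1) * scaleC (of_nat n) 1"
      using n by (simp add: sum.delta)
    finally show ?thesis by (simp add: scaleC_of_nat mult.commute)
  qed
  define U where "U = (\<Sum>k<n. T k)"
  \<comment> \<open>Multiply each resolvent equation by its cofactor and add up.\<close>
  have "q ((\<Sum>k<n. ((b - scaleC (\<omega> k) 1) * T k - 1) * E k)) = 0"
    by (intro null_sum null_mult T)
  also have "(\<Sum>k<n. ((b - scaleC (\<omega> k) 1) * T k - 1) * E k)
      = (\<Sum>k<n. (b ^ n - scaleC (h ^ n) 1) * T k - E k)"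
  proof (intro sum.cong refl)
    fix k
    have "((b - scaleC (\<omega> k) 1) * T k - 1) * E k = ((b - scaleC (\<omega> k) 1) * E k) * T k - E k"
      by (simp add: algebra_simps)
    then show "((b - scaleC (\<omega> k) 1) * T k - 1) * E k = (b ^ n - scaleC (h ^ n) 1) * T k - E k"
      unfolding E .
  qed
  also have "\<dots> = (b ^ n - scaleC (h ^ n) 1) * U - of_nat n * b ^ (n - 1)"
    by (simp add: sum_subtractf sum_E U_def sum_distrib_left)
  finally have U: "q ((b ^ n - scaleC (h ^ n) 1) * U - of_nat n * b ^ (n - 1)) = 0" .
  have pow: "q (b ^ j * B ^ j - 1) = 0" for j
  proof (induction j)
    case (Suc j)
    have "b ^ Suc j * B ^ Suc j - 1 = (b ^ j * B ^ j - 1) * (b * B) + (b * B - 1)"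
      by (simp add: algebra_simps)
    moreover have "q \<dots> = 0" by (intro null_add null_mult(1) Suc bB)
    ultimately show ?case by (simp only:)
  qed (simp add: zero)
  have Bn: "B ^ n = B ^ (n - 1) * B" using n by (cases n) (simp_all add: mult.commute)
  \<comment> \<open>Multiply \<open>U\<close> by \<open>B ^ n\<close>, the inverse of
    \<open>b ^ n\<close> up to null elements: \<open>n B\<close> differs from \<open>U\<close> only
    by a term carrying the factor \<open>h ^ n\<close>.\<close>
  have "of_nat n * B - (U - scaleC (h ^ n) 1 * B ^ n * U)
      = (b ^ n * B ^ n - 1) * U
        + - (((b ^ n - scaleC (h ^ n) 1) * U - of_nat n * b ^ (n - 1)) * B ^ n)
        + - (of_nat n * B * (b ^ (n - 1) * B ^ (n - 1) - 1))"
    unfolding Bn by (simp add: algebra_simps)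
  moreover have "q \<dots> = 0"
    by (intro null_add null_minus null_mult(1)[OF U] null_mult(1)[OF pow] null_mult(2)[OF pow])
  ultimately have eq: "q (of_nat n * B) = q (U - scaleC (h ^ n) 1 * B ^ n * U)"
    by (intro cong) simp
  have "0 \<le> M" using nonneg M order_trans by blast
  have powB: "q (B ^ j) \<le> M ^ j" for j
  proof (induction j)
    case (Suc j)
    have "q (B ^ Suc j) \<le> q B * q (B ^ j)" using mult_le by simp
    also have "\<dots> \<le> M * M ^ j" using Suc w nonneg \<open>0 \<le> M\<close> by (intro mult_mono) (auto simp: B_def)
    finally show ?case by simp
  qed (simp add: one)
  \<comment> \<open>The vertex \<open>k = 0\<close> is \<open>w + h\<close> itself. It is kept,
    while the other \<open>n - 1\<close> values are bounded by \<open>M\<close>.\<close>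
  have "U = T 0 + (\<Sum>k\<in>{1..<n}. T k)"
    using n by (simp add: U_def lessThan_atLeast0 sum.atLeast_Suc_lessThan)
  then have "q U \<le> q (T 0) + (\<Sum>k\<in>{1..<n}. q (T k))"
    using add_le sum_le[of T "{1..<n}"] by (metis add_left_mono order_trans)
  also have "(\<Sum>k\<in>{1..<n}. q (T k)) \<le> (n - 1) * M"
    using sum_bounded_above[of "{1..<n}" "\<lambda>k. q (T k)" M] M by (simp add: T_def)
  finally have qU: "q U \<le> q (R (w + h)) + (real n - 1) * M"
    using n by (simp add: T_def \<omega>_def of_nat_diff)
  \<comment> \<open>This cruder bound is for the error term, which is small because of
    \<open>h ^ n\<close>.\<close>
  have "q U \<le> (\<Sum>k<n. q (T k))" unfolding U_def by (rule sum_le)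
  also have "\<dots> \<le> n * M"
    using sum_bounded_above[of "{..<n}" "\<lambda>k. q (T k)" M] M by (simp add: T_def)
  finally have qU': "q U \<le> n * M" .
  have "real n * M = q (of_nat n * B)"
    using scaleC[of "of_nat n" B] w by (simp add: scaleC_of_nat B_def)
  also have "\<dots> \<le> q U + q (scaleC (h ^ n) (B ^ n * U))"
    unfolding eq by (simp add: mult_scaleC_left diff_le)
  also have "q (scaleC (h ^ n) (B ^ n * U)) \<le> cmod h ^ n * (M ^ n * (n * M))"
    unfolding scaleC norm_power
    by (intro mult_left_mono order_trans[OF mult_le] mult_mono powB qU')
       (auto simp: nonneg \<open>0 \<le> M\<close>)
  finally show ?thesis
    using qU by (simp add: algebra_simps power_mult_distrib)
qed

text \<open>Otherwise \<open>a\<close> has a resolvent \<open>R\<close> on the whole plane. Its size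
  attains a maximum, which by the mean value estimate spreads over discs of a fixed radius and hence
  arbitrarily far out, although the resolvent decays at infinity.\<close>

lemma Gelfand_Mazur:
  assumes inv: "\<And>x. q x \<noteq> 0 \<Longrightarrow> \<exists>y. q (x * y - 1) = 0"
  shows "\<exists>c. q (a - scaleC c 1) = 0"
proof (rule ccontr)
  assume "\<not> ?thesis"
  then have "\<forall>c. \<exists>y. q ((a - scaleC c 1) * y - 1) = 0" using inv by blast
  then obtain R where R: "\<And>c. q ((a - scaleC c 1) * R c - 1) = 0" by metis
  have pos: "q (R c) > 0" for c
  proof -
    have "q ((a - scaleC c 1) * R c) = 1" using cong[OF R[of c]] one by simp
    then have "q (R c) \<noteq> 0" using null_mult(2) by force
    then show ?thesis using nonneg[of "R c"] by linarith
  qed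
  \<comment> \<open>The reciprocal of the size of the resolvent is 1-Lipschitz and grows at
    infinity, so a minimum of \<open>g\<close> is easy to find.\<close>
  define g where "g c = 1 / q (R c)" for c
  have g_pos: "g c > 0" for c using pos by (simp add: g_def)
  \<comment> \<open>The resolvent identity \<open>R c - R d = (c - d) R c R d\<close>, up to null
    elements.\<close>
  have step: "q (R c) - q (R d) \<le> cmod (c - d) * (q (R c) * q (R d))" for c d
  proof -
    have "R c - R d - scaleC (c - d) (R c * R d) =
        ((a - scaleC c 1) * R c - 1) * R d + - (R c * ((a - scaleC d 1) * R d - 1))"
      by (simp add: algebra_simps scaleC_diff_left mult_scaleC_left mult_scaleC_right)
    moreover have "q \<dots> = 0" by (intro null_add null_minus null_mult R)
    ultimately have "q (R c - R d) = q (scaleC (c - d) (R c * R d))" by (intro cong) simp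
    also have "\<dots> \<le> cmod (c - d) * (q (R c) * q (R d))"
      unfolding scaleC by (intro mult_left_mono mult_le) simp
    finally show ?thesis using add_le[of "R c - R d" "R d"] by simp
  qed
  have g_diff: "g d - g c \<le> cmod (c - d)" for c d
    using step[of c d] pos[of c] pos[of d] by (simp add: g_def field_simps)
  have lip: "\<bar>g c - g d\<bar> \<le> dist c d" for c d
    using g_diff[of c d] g_diff[of d c] by (simp add: dist_norm norm_minus_commute abs_le_iff)
  have cont: "continuous_on UNIV g"
    unfolding continuous_on_iff
  proof safe
    fix c :: complex and e :: real
    assume "e > 0"
    then show "\<exists>d>0. \<forall>c'\<in>UNIV. dist c' c < d \<longrightarrow> dist (g c') (g c) < e"
      by (intro exI[of _ e]) (auto simp: dist_real_def intro: le_less_trans[OF lip])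
  qed
  \<comment> \<open>Up to null elements \<open>c R c = a R c - 1\<close>; take \<open>q\<close> and
    divide by \<open>q (R c)\<close>.\<close>
  have growth: "g c \<ge> cmod c - q a" for c
  proof -
    have "scaleC c (R c) - (a * R c - 1) = - ((a - scaleC c 1) * R c - 1)"
      by (simp add: algebra_simps mult_scaleC_right)
    then have "q (scaleC c (R c)) = q (a * R c - 1)"
      using R[of c] by (intro cong) (simp only: minus)
    also have "\<dots> \<le> q a * q (R c) + 1"
      using diff_le[of "a * R c" 1] mult_le[of a "R c"] one by linarith
    finally show ?thesis using pos[of c] by (simp add: scaleC g_def field_simps)
  qed
  \<comment> \<open>Outside this disc \<open>growth\<close> gives \<open>g c \<ge> g 0\<close>, so
    the minimum over the disc is global.\<close>
  define r where "r = q a + g 0"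
  have "0 \<in> cball (0::complex) r" using nonneg[of a] g_pos[of 0] by (simp add: r_def)
  then have "\<exists>w\<in>cball 0 r. \<forall>c\<in>cball 0 r. g w \<le> g c"
    by (intro continuous_attains_inf continuous_on_subset[OF cont]) auto
  then obtain w where w: "\<And>c. c \<in> cball 0 r \<Longrightarrow> g w \<le> g c" by blast
  define m where "m = g w"
  have m: "m \<le> g c" for c
  proof (cases "c \<in> cball 0 r")
    case False
    then have "g 0 \<le> g c" using growth[of c] by (simp add: r_def)
    then show ?thesis using w[OF \<open>0 \<in> cball 0 r\<close>] by (simp add: m_def)
  qed (simp add: m_def w)
  have m_pos: "m > 0" by (simp add: m_def g_pos)
  have le: "q (R c) \<le> 1 / m" for c
    using m[of c] m_pos pos[of c] by (simp add: g_def field_simps)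
  \<comment> \<open>Let \<open>n\<close> tend to infinity in the mean value estimate: the error
    vanishes because \<open>cmod h / m < 1\<close>.\<close>
  have spread: "g (v + h) = m" if v: "g v = m" and h: "cmod h < m" for v h
  proof -
    have v': "q (R v) = 1 / m" using v by (auto simp: g_def)
    have "(\<lambda>n. real n * (cmod h * (1 / m)) ^ n) \<longlonglongrightarrow> 0"
      using h m_pos by (intro powser_times_n_limit_0) simp
    then have "(\<lambda>n. 1 / m * (real n * (cmod h * (1 / m)) ^ n)) \<longlonglongrightarrow> 1 / m * 0"
      by (intro tendsto_mult tendsto_const)
    moreover have "eventually (\<lambda>n. 1 / m - q (R (v + h)) \<le> 1 / m * (real n * (cmod h * (1 / m)) ^ n)) sequentially"
      using eventually_gt_at_top[of 0]
      by eventually_elim (intro resolvent_mean_value[of a] R le v')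
    ultimately have "1 / m - q (R (v + h)) \<le> 1 / m * 0"
      by (intro tendsto_lowerbound) auto
    then have "q (R (v + h)) = 1 / m" using le[of "v + h"] by simp
    then show ?thesis by (simp add: g_def)
  qed
  \<comment> \<open>Walk away from \<open>w\<close> in steps of length \<open>m / 2\<close>, each
    inside the disc of \<open>spread\<close>; the constant value \<open>m\<close> finally
    contradicts \<open>growth\<close>.\<close>
  have "g (w + of_nat k * of_real (m / 2)) = m" for k
  proof (induction k)
    case (Suc k)
    have "cmod (of_real (m / 2)) < m" using m_pos by simp
    from spread[OF Suc this] show ?case by (simp add: distrib_right add_ac del: of_real_divide)
  qed (simp add: m_def)
  then have *: "real k * (m / 2) - cmod w - q a \<le> m" for k
    using growth[of "w + of_nat k * of_real (m / 2)"]
      norm_diff_ineq[of "of_nat k * of_real (m / 2)" w] m_pos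
    by (simp add: norm_mult add.commute)
  obtain k where "real k * (m / 2) > m + cmod w + q a"
    using reals_Archimedean3[of "m / 2"] m_pos by (meson half_gt_zero)
  then show False using *[of k] by linarith
qed

end

section \<open>Maximal ideals and their residue fields\<close>

lemma module_mult: "module ((*) :: 'a::comm_ring_1 \<Rightarrow> 'a \<Rightarrow> 'a)"
  by unfold_locales (simp_all add: algebra_simps)

abbreviation is_ideal :: "'a::comm_ring_1 set \<Rightarrow> bool" where
  "is_ideal \<equiv> module.subspace (*)"

lemma ideal_iff:
  "is_ideal I \<longleftrightarrow> 0 \<in> I \<and> (\<forall>x\<in>I. \<forall>y\<in>I. x + y \<in> I) \<and> (\<forall>c. \<forall>x\<in>I. c * x \<in> I)"
  by (rule module.subspace_def[OF module_mult])

lemmas ideal_zero = module.subspace_0[OF module_mult]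
  and ideal_add = module.subspace_add[OF module_mult]
  and ideal_mult = module.subspace_scale[OF module_mult]
  and ideal_minus = module.subspace_neg[OF module_mult]
  and ideal_diff = module.subspace_diff[OF module_mult]

lemma ideal_eq_UNIV_iff: "is_ideal I \<Longrightarrow> I = UNIV \<longleftrightarrow> 1 \<in> I"
  using ideal_mult[of I 1] by auto

text \<open>Zorn's lemma among the ideals that contain \<open>x\<close> but not 1; the principal
  ideal of \<open>x\<close> is one of them because \<open>x\<close> is no unit.\<close>

lemma exists_maximal_ideal:
  fixes x :: "'a::comm_ring_1"
  assumes "\<not> x dvd 1"
  obtains I where "maximal_ideal I" "x \<in> I"
proof -
  define F where "F = {I. is_ideal I \<and> 1 \<notin> I \<and> x \<in> I}"
  have "range ((*) x) \<in> F"
    unfolding F_def ideal_iff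
  proof (intro CollectI conjI ballI allI)
    show "0 \<in> range ((*) x)" by (metis mult_zero_right rangeI)
    show "x \<in> range ((*) x)" by (metis mult.right_neutral rangeI)
    show "1 \<notin> range ((*) x)" using assms by (auto intro: dvdI)
    fix y z c assume "y \<in> range ((*) x)" "z \<in> range ((*) x)"
    then obtain s t where "y = x * s" "z = x * t" by blast
    then have "y + z = x * (s + t)" by (simp add: distrib_left)
    then show "y + z \<in> range ((*) x)" by simp
  next
    fix c y assume "y \<in> range ((*) x)"
    then obtain s where "y = x * s" by blast
    then have "c * y = x * (c * s)" by (simp add: mult.left_commute)
    then show "c * y \<in> range ((*) x)" by simp
  qed
  then have "F \<noteq> {}" by blast
  moreover have "\<Union>C \<in> F" if "C \<noteq> {}" and ch: "subset.chain F C" for C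
  proof -
    have CF: "\<And>I. I \<in> C \<Longrightarrow> is_ideal I \<and> 1 \<notin> I \<and> x \<in> I"
      using ch by (auto simp: subset_chain_def F_def)
    have "is_ideal (\<Union>C)"
      unfolding ideal_iff
    proof (intro conjI ballI allI)
      show "0 \<in> \<Union>C" using \<open>C \<noteq> {}\<close> CF ideal_zero by blast
      fix y z c assume y: "y \<in> \<Union>C"
      then show "c * y \<in> \<Union>C" using CF ideal_mult by blast
      assume z: "z \<in> \<Union>C"
      obtain I J where IJ: "I \<in> C" "J \<in> C" "y \<in> I" "z \<in> J" using y z by blast
      then have "I \<subseteq> J \<or> J \<subseteq> I" using ch by (auto simp: subset_chain_def)
      then show "y + z \<in> \<Union>C" using IJ CF ideal_add by blast
    qed
    then show ?thesis using CF \<open>C \<noteq> {}\<close> by (auto simp: F_def)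
  qed
  ultimately obtain I where I: "I \<in> F" and max: "\<And>J. J \<in> F \<Longrightarrow> I \<subseteq> J \<Longrightarrow> J = I"
    using subset_Zorn_nonempty[of F] by blast
  have "maximal_ideal I"
    unfolding maximal_ideal_def
  proof (intro conjI allI impI)
    show "is_ideal I" "I \<noteq> UNIV" using I by (auto simp: F_def)
    fix J assume "is_ideal J \<and> I \<subseteq> J"
    then show "J = I \<or> J = UNIV" using max[of J] I ideal_eq_UNIV_iff[of J] by (auto simp: F_def)
  qed
  moreover have "x \<in> I" using I by (simp add: F_def)
  ultimately show ?thesis by (rule that)
qed

lemma infdist_approx:
  assumes "A \<noteq> {}" "infdist x A < s"
  shows "\<exists>a\<in>A. dist x a < s"
  using assms cInf_lessD[of "dist x ` A" s] by (auto simp: infdist_notempty)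

text \<open>The distance to an ideal, a seminorm on the algebra itself, stands for the norm of the
  quotient algebra.\<close>

lemma submultiplicative_seminorm_infdist:
  fixes I :: "'s::comm_complex_banach_algebra_1 set"
  assumes I: "is_ideal I" and "1 \<notin> I"
  shows "submultiplicative_seminorm (\<lambda>x. infdist x I)"
proof
  have ne: "I \<noteq> {}" using ideal_zero[OF I] by blast
  note approx = infdist_approx[OF ne]
  show "infdist (x + y) I \<le> infdist x I + infdist y I" for x y
  proof (rule field_le_epsilon)
    fix e :: real assume "e > 0"
    then have "\<exists>i\<in>I. dist x i < infdist x I + e / 2" "\<exists>j\<in>I. dist y j < infdist y I + e / 2"
      by (simp_all add: approx)
    then obtain i j where i: "i \<in> I" "dist x i < infdist x I + e / 2"
      and j: "j \<in> I" "dist y j < infdist y I + e / 2" by blast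
    have "dist (x + y) (i + j) \<le> dist x i + dist y j" by (rule dist_triangle_add)
    then show "infdist (x + y) I \<le> infdist x I + infdist y I + e"
      using i j by (intro infdist_le2[OF ideal_add[OF I i(1) j(1)]]) linarith
  qed
  show "infdist (x * y) I \<le> infdist x I * infdist y I" for x y
  proof -
    have *: "infdist (x * y) I \<le> (infdist x I + e) * (infdist y I + e)" if e: "e > 0" for e
    proof -
      have "\<exists>i\<in>I. dist x i < infdist x I + e" "\<exists>j\<in>I. dist y j < infdist y I + e"
        using e by (simp_all add: approx)
      then obtain i j where i: "i \<in> I" "dist x i < infdist x I + e"
        and j: "j \<in> I" "dist y j < infdist y I + e" by blast
      \<comment> \<open>Chosen so that \<open>x * y\<close> minus this element factors as
        \<open>(x - i) * (y - j)\<close>.\<close>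
      have "y * i + (x - i) * j \<in> I" using i j I by (intro ideal_add ideal_mult)
      moreover have "dist (x * y) (y * i + (x - i) * j) = norm ((x - i) * (y - j))"
        by (simp add: dist_norm algebra_simps)
      moreover have "\<dots> \<le> (infdist x I + e) * (infdist y I + e)"
        using i j
        by (intro order_trans[OF norm_mult_ineq] mult_mono)
           (auto simp: dist_norm infdist_nonneg intro: add_nonneg_nonneg less_imp_le[OF e])
      ultimately show ?thesis by (intro infdist_le2) auto
    qed
    have lim: "((\<lambda>e. (infdist x I + e) * (infdist y I + e)) \<longlongrightarrow> (infdist x I + 0) * (infdist y I + 0)) (at_right 0)"
      by (intro tendsto_intros)
    have ev: "\<forall>\<^sub>F e in at_right 0. infdist (x * y) I \<le> (infdist x I + e) * (infdist y I + e)"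
      using eventually_at_right_less[of 0] by eventually_elim (rule *)
    show ?thesis
      using tendsto_lowerbound[OF lim ev] by simp
  qed
  have scale: "infdist (scaleC c x) I \<le> cmod c * infdist x I" if "c \<noteq> 0" for c x
  proof (rule field_le_epsilon)
    fix e :: real assume "e > 0"
    then have "\<exists>i\<in>I. dist x i < infdist x I + e / cmod c"
      using that by (simp add: approx)
    then obtain i where i: "i \<in> I" "dist x i < infdist x I + e / cmod c" by blast
    have "scaleC c i \<in> I" using ideal_mult[OF I i(1), of "scaleC c 1"] by (simp add: mult_scaleC_left)
    moreover have "dist (scaleC c x) (scaleC c i) = cmod c * dist x i"
      by (simp add: dist_norm scaleC_diff_right[symmetric] norm_scaleC)
    moreover have "cmod c * dist x i \<le> cmod c * (infdist x I + e / cmod c)"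
      using i by (intro mult_left_mono) auto
    moreover have "cmod c * (infdist x I + e / cmod c) = cmod c * infdist x I + e"
      using that by (simp add: algebra_simps)
    ultimately show "infdist (scaleC c x) I \<le> cmod c * infdist x I + e"
      by (intro infdist_le2[of "scaleC c i"]) auto
  qed
  show "infdist (scaleC c x) I = cmod c * infdist x I" for c x
  proof (cases "c = 0")
    case False
    \<comment> \<open>The reverse inequality is \<open>scale\<close> for the inverse scalar.\<close>
    have "infdist x I \<le> cmod (1 / c) * infdist (scaleC c x) I"
      using scale[of "1 / c" "scaleC c x"] False by (simp add: scaleC_scaleC)
    then have "cmod c * infdist x I \<le> infdist (scaleC c x) I"
      using False by (simp add: norm_divide field_simps)
    then show ?thesis using scale[OF False, of x] by simp
  qed (simp add: ideal_zero[OF I])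
  \<comment> \<open>A proper ideal keeps distance 1 from the identity: anything closer is a unit by
    the Neumann series.\<close>
  have "1 \<le> dist 1 i" if "i \<in> I" for i
  proof (rule ccontr)
    assume "\<not> 1 \<le> dist 1 i"
    then have "i dvd 1" by (intro norm_one_minus_less_one_imp_unit) (simp add: dist_norm)
    then obtain k where "1 = k * i" by (metis dvdE mult.commute)
    then show False using ideal_mult[OF I that, of k] \<open>1 \<notin> I\<close> by simp
  qed
  then have "1 \<le> infdist 1 I" using ne by (auto simp: infdist_notempty intro: cINF_greatest)
  moreover have "infdist 1 I \<le> 1" by (rule infdist_le2[OF ideal_zero[OF I]]) simp
  ultimately show "infdist 1 I = (1::real)" by simp
qed

text \<open>A maximal ideal is closed, so its elements are exactly those at distance 0, and
  everything else is invertible modulo it. The Gelfand-Mazur theorem then applies to the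
  distance.\<close>

lemma maximal_ideal_residue_field:
  fixes I :: "'s::comm_complex_banach_algebra_1 set"
  assumes "maximal_ideal I"
  shows "\<exists>c. a - scaleC c 1 \<in> I"
proof -
  have I: "is_ideal I" and max: "\<And>J. is_ideal J \<Longrightarrow> I \<subseteq> J \<Longrightarrow> J = I \<or> J = UNIV"
    and "I \<noteq> UNIV"
    using assms by (auto simp: maximal_ideal_def)
  then have "1 \<notin> I" using ideal_eq_UNIV_iff by blast
  interpret submultiplicative_seminorm "\<lambda>x. infdist x I"
    by (rule submultiplicative_seminorm_infdist) fact+
  \<comment> \<open>The closure of \<open>I\<close>, an ideal that misses 1 because the distance of
    1 from \<open>I\<close> is 1.\<close>
  define J where "J = {x. infdist x I = 0}"
  have "is_ideal J" unfolding ideal_iff J_def by (simp add: zero null_add null_mult)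
  moreover have "I \<subseteq> J" by (auto simp: J_def)
  moreover have "J \<noteq> UNIV" using one unfolding J_def by (metis UNIV_I mem_Collect_eq zero_neq_one)
  ultimately have "J = I" using max by blast
  have "\<exists>y. infdist (x * y - 1) I = 0" if "infdist x I \<noteq> 0" for x
  proof -
    \<comment> \<open>The ideal generated by \<open>I\<close> and \<open>x\<close>; by maximality it
      contains 1, which exhibits an inverse of \<open>x\<close> modulo \<open>I\<close>.\<close>
    define K where "K = {i + s * x | i s. i \<in> I}"
    have K: "i + s * x \<in> K" if "i \<in> I" for i s using that by (auto simp: K_def)
    have "is_ideal K"
      unfolding ideal_iff
    proof (intro conjI ballI allI)
      show "0 \<in> K" using K[OF ideal_zero[OF I], of 0] by simp
      fix y z c assume "y \<in> K"
      then obtain i s where y: "y = i + s * x" "i \<in> I" by (auto simp: K_def)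
      show "c * y \<in> K" using K[OF ideal_mult[OF I y(2), of c], of "c * s"] by (simp add: y(1) algebra_simps)
      assume "z \<in> K"
      then obtain j t where z: "z = j + t * x" "j \<in> I" by (auto simp: K_def)
      show "y + z \<in> K"
        using K[OF ideal_add[OF I y(2) z(2)], of "s + t"] by (simp add: y(1) z(1) algebra_simps)
    qed
    moreover have "I \<subseteq> K" using K[of _ 0] by auto
    moreover have "x \<in> K" using K[OF ideal_zero[OF I], of 1] by simp
    moreover have "x \<notin> I" using that \<open>J = I\<close> by (auto simp: J_def)
    ultimately have "1 \<in> K" using max[of K] by auto
    then obtain i s where "1 = i + s * x" "i \<in> I" by (auto simp: K_def)
    then have "x * s - 1 = - i" by (simp add: algebra_simps)
    then show ?thesis using ideal_minus[OF I \<open>i \<in> I\<close>] by (metis infdist_zero)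
  qed
  then obtain c where "infdist (a - scaleC c 1) I = 0" using Gelfand_Mazur by blast
  then show ?thesis using \<open>J = I\<close> by (auto simp: J_def)
qed

text \<open>The character sends an element to the scalar congruent to it modulo a maximal ideal
  containing \<open>x\<close>.\<close>

lemma exists_complex_homomorphism:
  fixes x :: "'s::comm_complex_banach_algebra_1"
  assumes "\<not> x dvd 1"
  obtains \<phi> where "\<phi> \<in> maximal_ideal_space" "\<phi> x = 0"
proof -
  obtain I where maxI: "maximal_ideal I" and "x \<in> I" using exists_maximal_ideal[OF assms] .
  then have I: "is_ideal I" and "1 \<notin> I"
    using ideal_eq_UNIV_iff[of I] by (auto simp: maximal_ideal_def)
  obtain \<phi> where \<phi>: "\<And>a. a - scaleC (\<phi> a) 1 \<in> I"
    using maximal_ideal_residue_field[OF maxI] by metis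
  \<comment> \<open>Two different scalars congruent modulo \<open>I\<close> would put a unit into
    \<open>I\<close>. Every homomorphism law below follows from this uniqueness.\<close>
  have uniq: "\<phi> a = c" if "a - scaleC c 1 \<in> I" for a c
  proof (rule ccontr)
    assume "\<phi> a \<noteq> c"
    have "scaleC (\<phi> a - c) 1 \<in> I"
      using ideal_diff[OF I that \<phi>[of a]] by (simp add: scaleC_diff_left)
    then have "scaleC (1 / (\<phi> a - c)) 1 * scaleC (\<phi> a - c) 1 \<in> I" by (rule ideal_mult[OF I])
    then show False using \<open>\<phi> a \<noteq> c\<close> \<open>1 \<notin> I\<close> by (simp add: mult_scaleC_left scaleC_scaleC)
  qed
  have "\<phi> \<in> maximal_ideal_space"
    unfolding maximal_ideal_space_def
  proof (intro CollectI conjI allI)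
    show "\<phi> (a + b) = \<phi> a + \<phi> b" for a b
      using ideal_add[OF I \<phi>[of a] \<phi>[of b]] by (intro uniq) (simp add: scaleC_add_left algebra_simps)
    show "\<phi> (scaleC c a) = c * \<phi> a" for c a
      using ideal_mult[OF I \<phi>[of a], of "scaleC c 1"]
      by (intro uniq) (simp add: mult_scaleC_left scaleC_diff_right scaleC_scaleC)
    show "\<phi> (a * b) = \<phi> a * \<phi> b" for a b
      using ideal_add[OF I ideal_mult[OF I \<phi>[of a], of b] ideal_mult[OF I \<phi>[of b], of "scaleC (\<phi> a) 1"]]
      by (intro uniq) (simp add: mult_scaleC_left mult_scaleC_right scaleC_diff_right scaleC_scaleC algebra_simps)
    show "\<phi> 1 = 1" using ideal_zero[OF I] by (intro uniq) simp
  qed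
  moreover have "\<phi> x = 0" using \<open>x \<in> I\<close> by (intro uniq) simp
  ultimately show ?thesis by (rule that)
qed

lemma maximal_ideal_space_nonempty:
  "(maximal_ideal_space :: ('s::comm_complex_banach_algebra_1 \<Rightarrow> complex) set) \<noteq> {}"
proof -
  have "\<not> (0::'s) dvd 1" by simp
  then show ?thesis using exists_complex_homomorphism by blast
qed

text \<open>If \<open>\<phi> x\<close> exceeded the norm of \<open>x\<close>, then
  \<open>1 - x / \<phi> x\<close> would be a unit by the Neumann series and yet be killed by
  \<open>\<phi>\<close>.\<close>

lemma complex_homomorphism_norm_le:
  assumes "\<phi> \<in> maximal_ideal_space"
  shows "cmod (\<phi> x) \<le> norm x"
proof (rule ccontr)
  assume *: "\<not> ?thesis"
  have add: "\<phi> (x + y) = \<phi> x + \<phi> y" and scale: "\<phi> (scaleC c x) = c * \<phi> x"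
    and mult: "\<phi> (x * y) = \<phi> x * \<phi> y" and one: "\<phi> 1 = 1" for x y c
    using assms by (auto simp: maximal_ideal_space_def)
  define y where "y = scaleC (1 / \<phi> x) x"
  have "cmod (\<phi> x) > 0" using * norm_ge_zero[of x] by linarith
  then have "norm y < 1" using * by (simp add: y_def norm_scaleC norm_divide field_simps)
  then have "1 - y dvd 1" by (intro norm_one_minus_less_one_imp_unit) simp
  then obtain z where "1 = (1 - y) * z" by (auto elim: dvdE)
  then have "1 = \<phi> (1 - y) * \<phi> z" using mult one by metis
  moreover have "\<phi> (1 - y) = 0"
    using add[of "1 - y" y] scale[of "1 / \<phi> x" x] one \<open>cmod (\<phi> x) > 0\<close> by (simp add: y_def)
  ultimately show False by simp
qed

subsection \<open>Matrices over commutative rings\<close>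

lemma matrix_mult_diff_left: "(A - B) ** C = A ** C - B ** (C :: 'a::ring_1^'n^'m)"
  by (vector matrix_matrix_mult_def sum_subtractf[symmetric] left_diff_distrib)

lemma matrix_mult_diff_right: "A ** (B - C) = A ** B - A ** (C :: 'a::ring_1^'n^'m)"
  by (vector matrix_matrix_mult_def sum_subtractf[symmetric] right_diff_distrib)

lemma matrix_mult_add_left: "(A + B) ** C = A ** C + B ** (C :: 'a::semiring_1^'n^'m)"
  by (vector matrix_matrix_mult_def sum.distrib[symmetric] distrib_right)

lemma matrix_mult_minus_left: "(- A) ** C = - (A ** (C :: 'a::ring_1^'n^'m))"
  by (vector matrix_matrix_mult_def sum_negf[symmetric])

lemma matrix_mult_minus_right: "A ** (- C) = - (A ** (C :: 'a::ring_1^'n^'m))"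
  by (vector matrix_matrix_mult_def sum_negf[symmetric])

lemma sum_UNIV_sum_type:
  "(\<Sum>k\<in>UNIV. g k) = (\<Sum>k\<in>UNIV. g (Inl k :: 'c::finite + 'd::finite)) + (\<Sum>k\<in>UNIV. g (Inr k))"
  using sum.Plus[of UNIV UNIV g] by (simp add: UNIV_Plus_UNIV comp_def)

lemma hcat_mult_vcat: "hcat A B ** vcat C D = A ** C + B ** (D :: 'a::semiring_1^'n^'m)"
  by (simp add: vec_eq_iff matrix_matrix_mult_def hcat_def vcat_def sum_UNIV_sum_type)

lemma vcat_mult: "vcat A B ** C = vcat (A ** C) (B ** (C :: 'a::semiring_1^'n^'m))"
  by (auto simp: vec_eq_iff matrix_matrix_mult_def vcat_def split: sum.split)

lemma mult_hcat: "A ** hcat B C = hcat (A ** B) (A ** (C :: 'a::semiring_1^'n^'m))"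
  by (auto simp: vec_eq_iff matrix_matrix_mult_def hcat_def split: sum.split)

lemma map_matrix_vcat: "map_matrix f (vcat A B) = vcat (map_matrix f A) (map_matrix f B)"
  by (auto simp: vec_eq_iff vcat_def split: sum.split)

lemma map_matrix_hcat: "map_matrix f (hcat A B) = hcat (map_matrix f A) (map_matrix f B)"
  by (auto simp: vec_eq_iff hcat_def split: sum.split)

lemma mat_star_vcat: "mat_star s (vcat A B) = hcat (mat_star s A) (mat_star s B)"
  by (auto simp: vec_eq_iff vcat_def hcat_def mat_star_def split: sum.split)

lemma mat_star_hcat: "mat_star s (hcat A B) = vcat (mat_star s A) (mat_star s B)"
  by (auto simp: vec_eq_iff vcat_def hcat_def mat_star_def split: sum.split)

lemma vcat_mult_hcat_eq_one:
  assumes "A ** C = mat 1" "B ** D = mat 1" "A ** D = 0" "B ** C = 0"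
  shows "vcat A B ** hcat C D = (mat 1 :: 'a::semiring_1^('m::finite + 'n::finite)^('m::finite + 'n::finite))"
proof -
  have "(vcat A B ** hcat C D) $ i $ j = (mat 1 :: 'a^('m::finite + 'n::finite)^('m::finite + 'n::finite)) $ i $ j" for i j
  proof -
    have "(vcat A B ** hcat C D) $ i $ j =
      (case i of Inl k \<Rightarrow> (case j of Inl l \<Rightarrow> (A ** C) $ k $ l | Inr l \<Rightarrow> (A ** D) $ k $ l)
       | Inr k \<Rightarrow> (case j of Inl l \<Rightarrow> (B ** C) $ k $ l | Inr l \<Rightarrow> (B ** D) $ k $ l))"
      by (simp add: matrix_matrix_mult_def vcat_def hcat_def split: sum.split)
    then show ?thesis unfolding assms by (auto simp: mat_def split: sum.split)
  qed
  then show ?thesis by (simp add: vec_eq_iff)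
qed

text \<open>A common frame for \<open>emb\<close>, \<open>to_fract\<close>, the involution, complex
  conjugation and the characters, all of which act entrywise on matrices.\<close>

definition unital_ring_hom :: "('a::comm_ring_1 \<Rightarrow> 'b::comm_ring_1) \<Rightarrow> bool" where
  "unital_ring_hom f \<longleftrightarrow>
     f 1 = 1 \<and> (\<forall>x y. f (x + y) = f x + f y) \<and> (\<forall>x y. f (x * y) = f x * f y)"

context
  fixes f :: "'a::comm_ring_1 \<Rightarrow> 'b::comm_ring_1"
  assumes hom: "unital_ring_hom f"
begin

lemma hom_one: "f 1 = 1" and hom_add: "f (x + y) = f x + f y" and hom_mult: "f (x * y) = f x * f y"
  using hom by (auto simp: unital_ring_hom_def)

lemma hom_zero: "f 0 = 0"
  using hom_add[of 0 0] by simp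

lemma hom_minus: "f (- x) = - f x"
  using hom_add[of "- x" x] by (simp add: hom_zero eq_neg_iff_add_eq_0)

lemma hom_diff: "f (x - y) = f x - f y"
  using hom_add[of x "- y"] by (simp add: hom_minus)

lemma hom_sum: "f (\<Sum>i\<in>A. g i) = (\<Sum>i\<in>A. f (g i))"
  by (induction A rule: infinite_finite_induct) (auto simp: hom_zero hom_add)

lemma hom_prod: "f (\<Prod>i\<in>A. g i) = (\<Prod>i\<in>A. f (g i))"
  by (induction A rule: infinite_finite_induct) (auto simp: hom_one hom_mult)

lemma hom_of_int: "f (of_int k) = of_int k"
proof -
  have "f (of_nat n) = of_nat n" for n
    by (induction n) (auto simp: hom_zero hom_one hom_add)
  then show ?thesis by (cases k) (simp_all add: hom_minus hom_diff hom_one)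
qed

lemma hom_unit: "x dvd 1 \<Longrightarrow> f x dvd 1"
  by (metis dvd_def hom_mult hom_one)

lemma map_matrix_mult: "map_matrix f (A ** B) = map_matrix f A ** map_matrix f B"
  by (simp add: vec_eq_iff matrix_matrix_mult_def hom_sum hom_mult)

lemma map_matrix_add: "map_matrix f (A + B) = map_matrix f A + map_matrix f B"
  by (simp add: vec_eq_iff hom_add)

lemma map_matrix_diff: "map_matrix f (A - B) = map_matrix f A - map_matrix f B"
  by (simp add: vec_eq_iff hom_diff)

lemma map_matrix_minus: "map_matrix f (- A) = - map_matrix f A"
  by (simp add: vec_eq_iff hom_minus)

lemma map_matrix_one: "map_matrix f (mat 1) = mat 1"
  by (simp add: vec_eq_iff mat_def hom_zero hom_one)

lemma map_matrix_zero: "map_matrix f 0 = 0"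
  by (simp add: vec_eq_iff hom_zero)

lemma det_map_matrix: "det (map_matrix f A) = f (det A)"
  by (simp add: det_def hom_sum hom_mult hom_of_int hom_prod)

lemmas map_matrix_hom = map_matrix_mult map_matrix_add map_matrix_diff map_matrix_minus
  map_matrix_one map_matrix_zero map_matrix_vcat map_matrix_hcat

end

lemma map_matrix_inj: "inj f \<Longrightarrow> map_matrix f A = map_matrix f B \<longleftrightarrow> A = B"
  by (auto simp: vec_eq_iff inj_eq)

lemma unital_ring_hom_to_fract: "unital_ring_hom to_fract"
  by (simp add: unital_ring_hom_def)

lemma inj_to_fract: "inj to_fract"
  by (simp add: inj_def)

lemma mat_star_mult:
  fixes A :: "'a::comm_ring_1^'n^'m" and B :: "'a^'l^'n"
  assumes "unital_ring_hom s"
  shows "mat_star s (A ** B) = mat_star s B ** mat_star s A"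
  by (simp add: vec_eq_iff mat_star_def matrix_matrix_mult_def hom_sum[OF assms] hom_mult[OF assms]
      mult.commute)

lemma mat_star_minus: "unital_ring_hom s \<Longrightarrow> mat_star s (- A) = - mat_star s A"
  by (simp add: vec_eq_iff mat_star_def hom_minus)

lemma mat_star_mat_star: "(\<And>x. s (s x) = x) \<Longrightarrow> mat_star s (mat_star s A) = A"
  by (simp add: vec_eq_iff mat_star_def)

lemma det_mat_star: "unital_ring_hom s \<Longrightarrow> det (mat_star s A) = s (det A)"
  using det_map_matrix[of s "transpose A"]
  by (simp add: mat_star_def map_matrix_def transpose_def det_transpose[unfolded transpose_def])

lemma map_matrix_mat_star:
  "(\<And>x. f (s x) = t (f x)) \<Longrightarrow> map_matrix f (mat_star s A) = mat_star t (map_matrix f A)"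
  by (simp add: vec_eq_iff mat_star_def)

section \<open>Inverses of matrices\<close>

lemma matrix_inv_works:
  assumes "invertible A"
  shows "A ** matrix_inv A = mat 1" "matrix_inv A ** A = mat 1"
  using someI_ex[OF assms[unfolded invertible_def]] by (simp_all add: matrix_inv_def)

lemma matrix_inv_unique:
  fixes A B :: "'a::field^'n^'n"
  assumes "A ** B = mat 1"
  shows "matrix_inv A = B"
proof -
  have "invertible A" using assms invertible_right_inverse by blast
  then have "matrix_inv A ** (A ** B) = B"
    by (simp add: matrix_mul_assoc matrix_inv_works)
  then show ?thesis by (simp add: assms)
qed

lemma det_dvd_one: "A ** B = mat 1 \<Longrightarrow> det A dvd 1"
  by (metis det_I det_mul dvd_triv_left)

lemma unit_mult: "a dvd 1 \<Longrightarrow> b dvd 1 \<Longrightarrow> a * b dvd (1 :: 'a::comm_semiring_1)"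
  using mult_dvd_mono[of a 1 b 1] by simp

text \<open>By Cramer's rule in the field of fractions.\<close>

lemma matrix_inverse_of_unit_det:
  fixes A :: "'a::idom^'n^'n"
  assumes "det A dvd 1"
  obtains W where "A ** W = mat 1" "W ** A = mat 1"
proof -
  let ?F = "map_matrix to_fract"
  note h = unital_ring_hom_to_fract
  obtain u where u: "det A * u = 1" using assms by (metis dvdE)
  then have u': "to_fract (det A) * to_fract u = 1" by (metis to_fract_1 to_fract_mult)
  then have nz: "det (?F A) \<noteq> 0" by (auto simp: det_map_matrix[OF h])
  then have inv: "invertible (?F A)" by (simp add: invertible_det_nz)
  define V where "V = matrix_inv (?F A)"
  have V: "?F A ** V = mat 1" using inv by (simp add: V_def matrix_inv_works)
  \<comment> \<open>Cramer's quotients, with division by the determinant replaced by multiplication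
    by its inverse \<open>u\<close> in the ring.\<close>
  define W where "W = (\<chi> k l. u * det (\<chi> i j. if j = k then axis l 1 $ i else A $ i $ j))"
  have "?F W $ k $ l = V $ k $ l" for k l
  proof -
    have "?F A *v column l V = axis l 1"
      using V by (simp add: vec_eq_iff matrix_vector_mult_def matrix_matrix_mult_def column_def mat_def axis_def)
    then have "column l V = (\<chi> k. det (\<chi> i j. if j = k then axis l 1 $ i else ?F A $ i $ j) / det (?F A))"
      using cramer[OF nz] by blast
    then have "V $ k $ l = det (\<chi> i j. if j = k then axis l 1 $ i else ?F A $ i $ j) / det (?F A)"
      by (simp add: column_def vec_eq_iff)
    also have "(\<chi> i j. if j = k then axis l 1 $ i else ?F A $ i $ j)
        = ?F (\<chi> i j. if j = k then axis l 1 $ i else A $ i $ j)"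
      by (simp add: vec_eq_iff axis_def)
    also have "det \<dots> / det (?F A) = ?F W $ k $ l"
      using u' nz by (simp add: W_def det_map_matrix[OF h] field_simps)
    finally show ?thesis by simp
  qed
  then have "?F W = V" by (simp add: vec_eq_iff)
  then have "?F (A ** W) = ?F (mat 1)" using V by (simp add: map_matrix_hom[OF h])
  moreover have "?F (W ** A) = ?F (mat 1)"
    using \<open>?F W = V\<close> V by (simp add: map_matrix_hom[OF h] matrix_left_right_inverse)
  ultimately show ?thesis
    using that map_matrix_inj[OF inj_to_fract] by blast
qed

subsection \<open>Complex matrices\<close>

lemma unital_ring_hom_cnj: "unital_ring_hom cnj"
  by (simp add: unital_ring_hom_def)

text \<open>\<open>inner\<close> is the real part of the Hermitian product; the conjugate transpose
  is the adjoint for it as well.\<close>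

lemma inner_matrix_adjoint:
  fixes A :: "complex^'n^'m"
  shows "inner (A *v x) y = inner x (mat_star cnj A *v y)"
proof -
  have "inner (A *v x) y = (\<Sum>i\<in>UNIV. \<Sum>j\<in>UNIV. inner (A $ i $ j * x $ j) (y $ i))"
    by (simp add: inner_vec_def matrix_vector_mult_def inner_sum_left)
  also have "\<dots> = (\<Sum>j\<in>UNIV. \<Sum>i\<in>UNIV. inner (A $ i $ j * x $ j) (y $ i))"
    by (rule sum.swap)
  also have "\<dots> = (\<Sum>j\<in>UNIV. \<Sum>i\<in>UNIV. inner (x $ j) (cnj (A $ i $ j) * y $ i))"
    by (intro sum.cong refl) (simp add: inner_complex_def algebra_simps)
  also have "\<dots> = inner x (mat_star cnj A *v y)"
    by (simp add: inner_vec_def matrix_vector_mult_def inner_sum_right mat_star_def)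
  finally show ?thesis .
qed

lemma matrix_vector_mult_scaleR_complex:
  fixes A :: "complex^'n^'m"
  shows "A *v (c *\<^sub>R x) = c *\<^sub>R (A *v x)"
  using linear_scale[OF bounded_linear.linear[OF matrix_vector_mul_bounded_linear]] by blast

lemma scaleR_matrix_vector_mult:
  fixes A :: "complex^'n^'m"
  shows "(c *\<^sub>R A) *v x = c *\<^sub>R (A *v x)"
  by (simp add: vec_eq_iff matrix_vector_mult_def scaleR_sum_right)

lemma norm_isometry:
  fixes A :: "complex^'n^'m"
  assumes "mat_star cnj A ** A = mat 1"
  shows "norm (A *v x) = norm x"
  by (simp add: norm_eq_sqrt_inner inner_matrix_adjoint matrix_vector_mul_assoc assms)

text \<open>The adjoint is an isometry, so Cauchy-Schwarz bounds the square of the norm of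
  \<open>A *v x\<close> by \<open>norm x\<close> times that norm.\<close>

lemma norm_coisometry_le:
  fixes A :: "complex^'n^'m"
  assumes "A ** mat_star cnj A = mat 1"
  shows "norm (A *v x) \<le> norm x"
proof -
  have adj: "norm (mat_star cnj A *v y) = norm y" for y
    by (rule norm_isometry) (simp add: mat_star_mat_star assms)
  have "norm (A *v x) * norm (A *v x) = inner (A *v x) (A *v x)"
    by (simp add: power2_norm_eq_inner flip: power2_eq_square)
  also have "\<dots> = inner x (mat_star cnj A *v (A *v x))"
    by (rule inner_matrix_adjoint)
  also have "\<dots> \<le> norm x * norm (A *v x)"
    using norm_cauchy_schwarz[of x "mat_star cnj A *v (A *v x)"] by (simp only: adj)
  finally show ?thesis
    by (cases "A *v x = 0") auto
qed

section \<open>Angles between subspaces\<close>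

text \<open>For unit vectors the arcsine of \<open>\<parallel>K x\<parallel>\<close> is the angle between \<open>x\<close> and the kernel
  of \<open>K\<close>; angles satisfy the triangle inequality.\<close>

lemma coisometry_angle:
  fixes K :: "complex^'n^'m"
  assumes K: "K ** mat_star cnj K = mat 1"
    and x: "norm x = 1" and y: "norm y = 1"
    and \<mu>: "0 \<le> \<mu>" "\<mu> \<le> norm (K *v x)"
    and d: "0 \<le> d" "d \<le> 1" "sqrt (1 - d\<^sup>2) \<le> inner x y"
  shows "sin (arcsin \<mu> - arcsin d) \<le> norm (K *v y)"
proof -
  \<comment> \<open>The orthogonal projection onto the range of the adjoint of \<open>K\<close>;
    \<open>z - Q z\<close> is the component of \<open>z\<close> in the kernel of
    \<open>K\<close>.\<close>
  define Q where "Q z = mat_star cnj K *v (K *v z)" for z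
  have KQ: "K *v Q z = K *v z" for z
    by (simp add: Q_def matrix_vector_mul_assoc matrix_mul_assoc K)
  have Q1: "inner z (Q w) = inner (K *v z) (K *v w)" for z w
    by (simp add: Q_def inner_matrix_adjoint)
  have Q2: "inner (Q z) w = inner (K *v z) (K *v w)" for z w
    using Q1[of w z] by (simp add: inner_commute)
  have orth: "inner (z - Q z) (w - Q w) = inner z w - inner (K *v z) (K *v w)" for z w
    by (simp add: inner_diff_left inner_diff_right Q1 Q2 KQ matrix_vector_mult_diff_distrib)
  define s t where "s = norm (K *v x)" and "t = norm (K *v y)"
  have s: "0 \<le> s" "s \<le> 1" and t: "0 \<le> t" "t \<le> 1"
    using norm_coisometry_le[OF K, of x] norm_coisometry_le[OF K, of y] x y by (auto simp: s_def t_def)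
  have rest: "norm (x - Q x) = sqrt (1 - s\<^sup>2)" "norm (y - Q y) = sqrt (1 - t\<^sup>2)"
    using x y by (simp_all add: norm_eq_sqrt_inner[of "x - Q x"] norm_eq_sqrt_inner[of "y - Q y"] orth
        s_def t_def power2_norm_eq_inner norm_eq_1)
  \<comment> \<open>Split along the kernel of \<open>K\<close> and its complement, apply
    Cauchy-Schwarz to both parts, and recognize the cosine of a difference.\<close>
  have "inner x y = inner (K *v x) (K *v y) + inner (x - Q x) (y - Q y)"
    by (simp add: orth)
  also have "\<dots> \<le> s * t + sqrt (1 - s\<^sup>2) * sqrt (1 - t\<^sup>2)"
    unfolding s_def t_def rest[unfolded s_def t_def, symmetric] by (intro add_mono norm_cauchy_schwarz)
  also have "\<dots> = cos (arcsin s - arcsin t)"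
    using s t by (simp add: cos_diff cos_arcsin)
  finally have "cos (arcsin d) \<le> cos (arcsin s - arcsin t)"
    using d by (simp add: cos_arcsin)
  then have *: "cos (arcsin d) \<le> cos \<bar>arcsin s - arcsin t\<bar>"
    by simp
  have bd: "0 \<le> arcsin d" "arcsin d \<le> pi / 2" "0 \<le> arcsin s" "arcsin s \<le> pi / 2"
    "0 \<le> arcsin t" "arcsin t \<le> pi / 2"
    using d s t arcsin_bounded[of d] arcsin_bounded[of s] arcsin_bounded[of t]
      arcsin_le_arcsin[of 0 d] arcsin_le_arcsin[of 0 s] arcsin_le_arcsin[of 0 t]
    by auto
  \<comment> \<open>Cosine decreases on \<open>[0, pi]\<close>.\<close>
  have "\<bar>arcsin s - arcsin t\<bar> \<le> arcsin d"
    using * cos_mono_le_eq[of "arcsin d" "\<bar>arcsin s - arcsin t\<bar>"] bd pi_gt_zero by auto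
  moreover have "arcsin \<mu> \<le> arcsin s" "0 \<le> arcsin \<mu>"
    using \<mu> s arcsin_le_arcsin[of \<mu> s] arcsin_le_arcsin[of 0 \<mu>] by (auto simp: s_def)
  ultimately have "sin (arcsin \<mu> - arcsin d) \<le> sin (arcsin t)"
    using bd by (intro sin_monotone_2pi_le) auto
  moreover have "sin (arcsin t) = t" using t by simp
  ultimately show ?thesis by (simp only: t_def)
qed

text \<open>Stacking \<open>Gt\<close> on the adjoint of \<open>G\<close> gives a square matrix with
  a one-sided inverse, and for square matrices the product in the other order is the identity
  too.\<close>

lemma isometry_complement:
  fixes G :: "complex^'m^('p::finite + 'm::finite)" and Gt :: "complex^('p + 'm)^'p"
  assumes "mat_star cnj G ** G = mat 1" "Gt ** mat_star cnj Gt = mat 1" "Gt ** G = 0"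
  shows "mat_star cnj Gt ** Gt + G ** mat_star cnj G = mat 1"
proof -
  have "mat_star cnj G ** mat_star cnj Gt = mat_star cnj (Gt ** G)"
    by (simp add: mat_star_mult unital_ring_hom_cnj)
  also have "\<dots> = 0" by (simp add: assms vec_eq_iff mat_star_def)
  finally have "vcat Gt (mat_star cnj G) ** hcat (mat_star cnj Gt) G = mat 1"
    using assms by (intro vcat_mult_hcat_eq_one) auto
  then have "hcat (mat_star cnj Gt) G ** vcat Gt (mat_star cnj G) = mat 1"
    by (simp add: matrix_left_right_inverse)
  then show ?thesis by (simp add: hcat_mult_vcat)
qed

text \<open>Pythagoras: \<open>x\<close> splits into its projections onto the range of
  \<open>G\<close> and onto the orthogonal complement, where \<open>Gt\<close> measures the
  length.\<close>

lemma isometry_complement_norm: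
  fixes G :: "complex^'m^('p::finite + 'm::finite)" and Gt :: "complex^('p + 'm)^'p"
  assumes "mat_star cnj G ** G = mat 1" "Gt ** mat_star cnj Gt = mat 1" "Gt ** G = 0"
  shows "(norm x)\<^sup>2 = (norm (Gt *v x))\<^sup>2 + (norm (mat_star cnj G *v x))\<^sup>2"
    and "norm (x - G *v (mat_star cnj G *v x)) = norm (Gt *v x)"
proof -
  have split: "x = mat_star cnj Gt *v (Gt *v x) + G *v (mat_star cnj G *v x)"
    using isometry_complement[OF assms]
    by (simp add: matrix_vector_mul_assoc flip: matrix_vector_mult_add_rdistrib)
  have "(norm x)\<^sup>2 = inner x (mat_star cnj Gt *v (Gt *v x)) + inner x (G *v (mat_star cnj G *v x))"
    by (subst (2) split) (simp add: power2_norm_eq_inner flip: inner_add_right split)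
  also have "inner x (G *v (mat_star cnj G *v x)) = inner (mat_star cnj G *v x) (mat_star cnj G *v x)"
    by (simp add: inner_matrix_adjoint mat_star_mat_star)
  finally show "(norm x)\<^sup>2 = (norm (Gt *v x))\<^sup>2 + (norm (mat_star cnj G *v x))\<^sup>2"
    by (simp add: power2_norm_eq_inner flip: inner_matrix_adjoint)
  have "x - G *v (mat_star cnj G *v x) = mat_star cnj Gt *v (Gt *v x)"
    using split by (metis add_diff_cancel_right')
  moreover have "norm (mat_star cnj Gt *v y) = norm y" for y
    using assms by (intro norm_isometry) (simp add: mat_star_mat_star)
  ultimately show "norm (x - G *v (mat_star cnj G *v x)) = norm (Gt *v x)" by simp
qed

text \<open>The vector \<open>G1 *v v\<close> is the projection of a suitable \<open>G0 *v u\<close>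
  onto the range of \<open>G1\<close>. The gap bounds the angle between the two, the margin bounds
  the angle of \<open>G0 *v u\<close> to the kernel of \<open>K\<close> from below, and
  \<open>coisometry_angle\<close> combines the bounds.\<close>

lemma robust_lower_bound:
  fixes G0 G1 :: "complex^'m^('p::finite + 'm::finite)"
    and Gt1 :: "complex^('p + 'm)^'p" and K :: "complex^('p + 'm)^'m"
  assumes G0: "mat_star cnj G0 ** G0 = mat 1"
    and G1: "mat_star cnj G1 ** G1 = mat 1"
    and Gt1: "Gt1 ** mat_star cnj Gt1 = mat 1" "Gt1 ** G1 = 0"
    and K: "K ** mat_star cnj K = mat 1"
    and det: "det (mat_star cnj G0 ** G1) \<noteq> 0"
    and gap: "\<And>u. norm ((Gt1 ** G0) *v u) \<le> d * norm u" and d: "0 \<le> d" "d \<le> 1"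
    and margin: "\<And>u. \<mu> * norm u \<le> norm ((K ** G0) *v u)" and "0 \<le> \<mu>"
  shows "sin (arcsin \<mu> - arcsin d) * norm v \<le> norm ((K ** G1) *v v)"
proof (cases "v = 0")
  case False
  \<comment> \<open>The determinant condition makes the projection from the range of
    \<open>G0\<close> to that of \<open>G1\<close> onto, so \<open>v\<close> has a preimage
    \<open>u\<close>.\<close>
  have "mat_star cnj G1 ** G0 = mat_star cnj (mat_star cnj G0 ** G1)"
    by (simp add: mat_star_mult unital_ring_hom_cnj mat_star_mat_star)
  then have "det (mat_star cnj G1 ** G0) \<noteq> 0"
    using det by (simp add: det_mat_star[OF unital_ring_hom_cnj])
  then obtain B where "(mat_star cnj G1 ** G0) ** B = mat 1"
    by (auto simp: invertible_right_inverse simp flip: invertible_det_nz)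
  then have u: "(mat_star cnj G1 ** G0) *v (B *v v) = v"
    by (simp add: matrix_vector_mul_assoc)
  define u where "u = B *v v"
  have uv: "mat_star cnj G1 *v (G0 *v u) = v" using u by (simp add: u_def matrix_vector_mul_assoc matrix_mul_assoc)
  have "u \<noteq> 0" using uv False by auto
  then have pos: "norm u > 0" "norm v > 0" using False by auto
  define x y where "x = (1 / norm u) *\<^sub>R (G0 *v u)" and "y = (1 / norm v) *\<^sub>R (G1 *v v)"
  have xy: "norm x = 1" "norm y = 1"
    using pos by (simp_all add: x_def y_def norm_isometry[OF G0] norm_isometry[OF G1])
  have "inner (G0 *v u) (G1 *v v) = inner v v"
    using inner_matrix_adjoint[of G1 v "G0 *v u"] by (simp add: uv inner_commute)
  then have ip: "inner x y = norm v / norm u"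
    using pos by (simp add: x_def y_def power2_norm_eq_inner[symmetric] power2_eq_square)
  \<comment> \<open>Pythagoras for \<open>G0 *v u\<close> bounds the cosine
    \<open>norm v / norm u\<close> from below by that of \<open>arcsin d\<close>.\<close>
  have "(norm u)\<^sup>2 = (norm ((Gt1 ** G0) *v u))\<^sup>2 + (norm v)\<^sup>2"
    using isometry_complement_norm(1)[OF G1 Gt1, of "G0 *v u"] norm_isometry[OF G0, of u]
    unfolding uv by (simp add: matrix_vector_mul_assoc)
  also have "(norm ((Gt1 ** G0) *v u))\<^sup>2 \<le> (d * norm u)\<^sup>2"
    by (intro power_mono gap norm_ge_zero)
  finally have "(1 - d\<^sup>2) * (norm u)\<^sup>2 \<le> (norm v)\<^sup>2"
    by (simp add: algebra_simps power_mult_distrib)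
  then have "1 - d\<^sup>2 \<le> (norm v / norm u)\<^sup>2"
    using pos by (simp add: power_divide field_simps)
  then have "sqrt (1 - d\<^sup>2) \<le> inner x y"
    unfolding ip using pos by (intro real_le_lsqrt) auto
  moreover have "\<mu> \<le> norm (K *v x)"
    using margin[of u] pos
    by (simp add: x_def matrix_vector_mult_scaleR_complex matrix_vector_mul_assoc field_simps)
  ultimately have "sin (arcsin \<mu> - arcsin d) \<le> norm (K *v y)"
    using xy d \<open>0 \<le> \<mu>\<close> by (intro coisometry_angle[OF K]) auto
  then show ?thesis
    using pos
    by (simp add: y_def matrix_vector_mult_scaleR_complex matrix_vector_mul_assoc field_simps)
qed simp

subsection \<open>The norm of the Gelfand transform and the index\<close>

text \<open>Crude, but characters do not increase the norm, so it bounds the operator norms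
  uniformly over all characters.\<close>

lemma norm_matrix_vector_le_sum:
  fixes A :: "complex^'n^'m"
  shows "norm (A *v x) \<le> (\<Sum>i\<in>UNIV. \<Sum>j\<in>UNIV. cmod (A $ i $ j)) * norm x"
proof -
  have "norm (A *v x) \<le> (\<Sum>i\<in>UNIV. cmod ((A *v x) $ i))"
    unfolding norm_vec_def by (rule L2_set_le_sum) simp
  also have "\<dots> \<le> (\<Sum>i\<in>UNIV. (\<Sum>j\<in>UNIV. cmod (A $ i $ j) * norm x))"
  proof (rule sum_mono)
    fix i
    have "cmod ((A *v x) $ i) \<le> (\<Sum>j\<in>UNIV. cmod (A $ i $ j * x $ j))"
      unfolding matrix_vector_mult_def by (simp add: norm_sum)
    also have "\<dots> \<le> (\<Sum>j\<in>UNIV. cmod (A $ i $ j) * norm x)"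
      by (intro sum_mono) (simp add: norm_mult mult_left_mono Finite_Cartesian_Product.norm_nth_le)
    finally show "cmod ((A *v x) $ i) \<le> \<dots>" .
  qed
  finally show ?thesis by (simp add: sum_distrib_right)
qed

lemma unital_ring_hom_character: "\<phi> \<in> maximal_ideal_space \<Longrightarrow> unital_ring_hom \<phi>"
  by (simp add: maximal_ideal_space_def unital_ring_hom_def)

lemma unit_iff_characters:
  "x dvd 1 \<longleftrightarrow> (\<forall>\<phi>\<in>maximal_ideal_space. \<phi> x \<noteq> 0)"
proof
  assume "x dvd 1"
  then show "\<forall>\<phi>\<in>maximal_ideal_space. \<phi> x \<noteq> 0"
    using hom_unit[OF unital_ring_hom_character] by force
qed (metis exists_complex_homomorphism)

lemma bdd_above_gelfand_norm:
  "bdd_above ((\<lambda>\<phi>. onorm (\<lambda>v. map_matrix \<phi> A *v v)) ` maximal_ideal_space)"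
proof (rule bdd_aboveI2)
  fix \<phi> :: "'a \<Rightarrow> complex"
  assume \<phi>: "\<phi> \<in> maximal_ideal_space"
  show "onorm (\<lambda>v. map_matrix \<phi> A *v v) \<le> (\<Sum>i\<in>UNIV. \<Sum>j\<in>UNIV. norm (A $ i $ j))"
  proof (rule onorm_bound)
    fix v
    have "norm (map_matrix \<phi> A *v v) \<le> (\<Sum>i\<in>UNIV. \<Sum>j\<in>UNIV. cmod (map_matrix \<phi> A $ i $ j)) * norm v"
      by (rule norm_matrix_vector_le_sum)
    also have "\<dots> \<le> (\<Sum>i\<in>UNIV. \<Sum>j\<in>UNIV. norm (A $ i $ j)) * norm v"
      using complex_homomorphism_norm_le[OF \<phi>] by (intro mult_right_mono sum_mono) auto
    finally show "norm (map_matrix \<phi> A *v v) \<le> \<dots>" .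
  qed (simp add: sum_nonneg)
qed

lemma norm_le_gelfand_norm:
  assumes "\<phi> \<in> maximal_ideal_space"
  shows "norm (map_matrix \<phi> A *v v) \<le> gelfand_norm A * norm v"
proof -
  have "norm (map_matrix \<phi> A *v v) \<le> onorm (\<lambda>v. map_matrix \<phi> A *v v) * norm v"
    by (rule onorm) simp
  also have "\<dots> \<le> gelfand_norm A * norm v"
    unfolding gelfand_norm_def
    by (intro mult_right_mono cSUP_upper[OF assms] bdd_above_gelfand_norm) simp
  finally show ?thesis .
qed

lemma gelfand_norm_le:
  assumes "0 \<le> b" "\<And>\<phi> v. \<phi> \<in> maximal_ideal_space \<Longrightarrow> norm (map_matrix \<phi> A *v v) \<le> b * norm v"
  shows "gelfand_norm A \<le> b"
  unfolding gelfand_norm_def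
  by (intro cSUP_least maximal_ideal_space_nonempty onorm_bound assms)

lemma gelfand_norm_nonneg: "0 \<le> gelfand_norm A"
proof -
  obtain \<phi> :: "'a \<Rightarrow> complex" where \<phi>: "\<phi> \<in> maximal_ideal_space"
    using maximal_ideal_space_nonempty by blast
  have "0 \<le> onorm (\<lambda>v. map_matrix \<phi> A *v v)" by (rule onorm_pos_le) simp
  also have "\<dots> \<le> gelfand_norm A"
    unfolding gelfand_norm_def by (intro cSUP_upper[OF \<phi>] bdd_above_gelfand_norm)
  finally show ?thesis .
qed

text \<open>Homotopy invariance: a connected image in a discrete space is a point.\<close>

lemma abstract_index_path:
  assumes "abstract_index star \<iota>"
    and f: "continuous_on {0..1::real} f" "\<And>t. t \<in> {0..1} \<Longrightarrow> f t dvd 1"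
  shows "\<iota> (f 0) = \<iota> (f 1)"
proof -
  have "continuous_map (top_of_set {0..1}) (top_of_set {a. a dvd 1}) f"
    using f by (auto simp: continuous_map_in_subtopology)
  moreover have "continuous_map (top_of_set {a. a dvd 1}) (discrete_topology UNIV) \<iota>"
    using assms(1) by (simp add: abstract_index_def)
  ultimately have "continuous_map (top_of_set {0..1::real}) (discrete_topology UNIV) (\<iota> \<circ> f)"
    by (rule continuous_map_compose)
  moreover have "connectedin (top_of_set {0..1::real}) {0..1}"
    by (simp add: connectedin_subtopology)
  ultimately have "connectedin (discrete_topology UNIV) ((\<iota> \<circ> f) ` {0..1})"
    by (rule connectedin_continuous_map_image)
  then obtain c where "(\<iota> \<circ> f) ` {0..1} \<subseteq> {c}"
    by (auto simp: connectedin_discrete_topology)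
  then have "(\<iota> \<circ> f) 0 = c" "(\<iota> \<circ> f) 1 = c"
    by (auto simp: image_subset_iff)
  then show ?thesis by simp
qed

lemma continuous_on_det:
  fixes A :: "'t::topological_space \<Rightarrow> 's::{real_normed_algebra_1, comm_ring_1}^'n^'n"
  assumes "\<And>i j. continuous_on T (\<lambda>t. A t $ i $ j)"
  shows "continuous_on T (\<lambda>t. det (A t))"
  unfolding det_def by (intro continuous_intros assms)

subsection \<open>Coprime factorizations and closed loops\<close>

text \<open>Clearing denominators on both sides gives
  \<open>T = Dc ** (mat 1 - C ** P) ** D\<close>; its inverse therefore yields that of the return
  difference.\<close>

lemma
  fixes N :: "'f::field^'m^'p" and D :: "'f^'m^'m" and Nc :: "'f^'p^'m" and Dc :: "'f^'m^'m"
  assumes D: "invertible D" and Dc: "invertible Dc"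
  defines "P \<equiv> N ** matrix_inv D" and "C \<equiv> matrix_inv Dc ** Nc"
    and "T \<equiv> hcat (- Nc) Dc ** vcat N D"
  shows invertible_return_difference: "invertible (mat 1 - C ** P) \<longleftrightarrow> invertible T"
    and closed_loop_eq: "invertible T \<Longrightarrow> closed_loop P C = vcat N D ** matrix_inv T ** hcat (- Nc) Dc"
proof -
  define Di Dci where "Di = matrix_inv D" and "Dci = matrix_inv Dc"
  have Di: "D ** Di = mat 1" "Di ** D = mat 1" and Dci: "Dc ** Dci = mat 1" "Dci ** Dc = mat 1"
    using matrix_inv_works[OF D] matrix_inv_works[OF Dc] by (simp_all add: Di_def Dci_def)
  have T: "T = Dc ** D - Nc ** N"
    by (simp add: T_def hcat_mult_vcat matrix_mult_minus_left)
  have PD: "P ** D = N"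
    by (simp add: P_def matrix_mul_assoc[symmetric] Di[unfolded Di_def])
  have DcC: "Dc ** C = Nc"
    by (simp add: C_def matrix_mul_assoc Dci[unfolded Dci_def])
  have T': "T = Dc ** (mat 1 - C ** P) ** D"
    by (simp add: T matrix_mult_diff_left matrix_mult_diff_right matrix_mul_assoc DcC)
       (simp add: PD matrix_mul_assoc[symmetric])
  have "det D \<noteq> 0" "det Dc \<noteq> 0" using D Dc by (simp_all add: invertible_det_nz)
  then show "invertible (mat 1 - C ** P) \<longleftrightarrow> invertible T"
    unfolding invertible_det_nz T' det_mul by simp
  assume inv: "invertible T"
  define Ti where "Ti = matrix_inv T"
  have Ti: "T ** Ti = mat 1" using matrix_inv_works[OF inv] by (simp add: Ti_def)
  have "mat 1 - C ** P = Dci ** T ** Di"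
  proof -
    have "Dci ** T ** Di = (Dci ** Dc) ** (mat 1 - C ** P) ** (D ** Di)"
      unfolding T' by (simp add: matrix_mul_assoc)
    then show ?thesis by (simp add: Di Dci)
  qed
  then have "(mat 1 - C ** P) ** (D ** Ti ** Dc) = Dci ** (T ** ((Di ** D) ** Ti)) ** Dc"
    by (simp add: matrix_mul_assoc)
  then have "(mat 1 - C ** P) ** (D ** Ti ** Dc) = mat 1"
    by (simp add: Di Ti Dci)
  then have "matrix_inv (mat 1 - C ** P) = D ** Ti ** Dc"
    by (rule matrix_inv_unique)
  then have "closed_loop P C = (vcat P (mat 1) ** D) ** Ti ** (Dc ** hcat (- C) (mat 1))"
    by (simp add: closed_loop_def matrix_mul_assoc)
  also have "vcat P (mat 1) ** D = vcat N D"
    by (simp add: vcat_mult PD)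
  also have "Dc ** hcat (- C) (mat 1) = hcat (- Nc) Dc"
    by (simp add: mult_hcat matrix_mult_minus_right DcC)
  finally show "closed_loop P C = vcat N D ** matrix_inv T ** hcat (- Nc) Dc"
    by (simp add: Ti_def)
qed

section \<open>Stabilization as invertibility over the ring\<close>

abbreviation fmat :: "'r::idom^'n^'k \<Rightarrow> 'r fract^'n^'k" where
  "fmat \<equiv> map_matrix to_fract"

context
  fixes P :: "'r::idom fract^'m^'p" and C :: "'r fract^'p^'m"
    and N :: "'r^'m^'p" and D :: "'r^'m^'m" and Nc :: "'r^'p^'m" and Dc :: "'r^'m^'m"
  assumes rcf: "right_coprime_factorization P N D"
    and lcf: "left_coprime_factorization C Nc Dc"
begin

lemma fract_inv: "invertible (fmat D)" "invertible (fmat Dc)"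
  and fract_quotients: "P = fmat N ** matrix_inv (fmat D)"
    "C = matrix_inv (fmat Dc) ** fmat Nc"
  using rcf lcf by (auto simp: right_coprime_factorization_def left_coprime_factorization_def)

lemma fract_loop:
  "hcat (- fmat Nc) (fmat Dc) ** vcat (fmat N) (fmat D) = fmat (hcat (- Nc) Dc ** vcat N D)"
  by (simp add: map_matrix_hom[OF unital_ring_hom_to_fract])

lemma fract_closed_loop:
  "invertible (fmat (hcat (- Nc) Dc ** vcat N D)) \<Longrightarrow>
    closed_loop P C = fmat (vcat N D) ** matrix_inv (fmat (hcat (- Nc) Dc ** vcat N D)) **
      fmat (hcat (- Nc) Dc)"
  using closed_loop_eq[OF fract_inv, where N = "fmat N" and Nc = "fmat Nc"]
  by (simp only: fract_loop flip: fract_quotients) (simp add: map_matrix_hom[OF unital_ring_hom_to_fract])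

text \<open>The Bezout identities strip the outer factors off the closed loop, leaving the inverse
  of the middle factor with entries in the ring.\<close>

lemma stabilizes_imp_unit_det:
  assumes "stabilizes C P"
  shows "det (hcat (- Nc) Dc ** vcat N D) dvd 1"
proof -
  have T: "invertible (fmat (hcat (- Nc) Dc ** vcat N D))"
    using assms unfolding stabilizes_def fract_quotients
    by (simp add: invertible_return_difference[OF fract_inv] fract_loop)
  obtain H where "fmat H = closed_loop P C" using assms by (auto simp: stabilizes_def)
  then have H: "fmat H = fmat (vcat N D) ** matrix_inv (fmat (hcat (- Nc) Dc ** vcat N D)) **
      fmat (hcat (- Nc) Dc)"
    using fract_closed_loop[OF T] by simp
  obtain X Y where "X ** N + Y ** D = mat 1"
    using rcf by (auto simp: right_coprime_factorization_def)
  then have XY: "hcat X Y ** vcat N D = mat 1" by (simp add: hcat_mult_vcat)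
  obtain X' Y' where "Nc ** X' + Dc ** Y' = mat 1"
    using lcf by (auto simp: left_coprime_factorization_def)
  \<comment> \<open>The sign of \<open>X'\<close> compensates for the sign of
    \<open>Nc\<close>.\<close>
  then have XY': "hcat (- Nc) Dc ** vcat (- X') Y' = mat 1"
    by (simp add: hcat_mult_vcat matrix_mult_minus_left matrix_mult_minus_right)
  have "fmat (hcat X Y ** H ** vcat (- X') Y')
      = fmat (hcat X Y ** vcat N D) **
        matrix_inv (fmat (hcat (- Nc) Dc ** vcat N D)) **
      fmat (hcat (- Nc) Dc ** vcat (- X') Y')"
    by (simp only: map_matrix_mult[OF unital_ring_hom_to_fract] H matrix_mul_assoc)
  also have "\<dots> = matrix_inv (fmat (hcat (- Nc) Dc ** vcat N D))"
    by (simp add: XY XY' map_matrix_hom[OF unital_ring_hom_to_fract])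
  finally have
    "fmat ((hcat (- Nc) Dc ** vcat N D) ** (hcat X Y ** H ** vcat (- X') Y')) = fmat (mat 1)"
    using matrix_inv_works(1)[OF T]
    by (simp only: map_matrix_mult[OF unital_ring_hom_to_fract] map_matrix_one[OF unital_ring_hom_to_fract])
  then show ?thesis by (simp only: map_matrix_inj[OF inj_to_fract] det_dvd_one)
qed

text \<open>The converse: \<open>W\<close> writes the closed loop over the ring, and injectivity of
  \<open>to_fract\<close> makes the described matrix unique.\<close>

lemma
  assumes W: "(hcat (- Nc) Dc ** vcat N D) ** W = mat 1"
  shows stabilizes_if_inverse: "stabilizes C P"
    and closed_loop_over_ring:
      "(THE H. fmat H = closed_loop P C) = vcat N D ** W ** hcat (- Nc) Dc"
proof -
  have "fmat (hcat (- Nc) Dc ** vcat N D) ** fmat W = mat 1"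
    using W by (metis map_matrix_mult map_matrix_one unital_ring_hom_to_fract)
  then have T: "invertible (fmat (hcat (- Nc) Dc ** vcat N D))"
    "matrix_inv (fmat (hcat (- Nc) Dc ** vcat N D)) = fmat W"
    by (auto simp: invertible_right_inverse matrix_inv_unique)
  then have H: "fmat (vcat N D ** W ** hcat (- Nc) Dc) = closed_loop P C"
    using fract_closed_loop[OF T(1)] unfolding T(2) by (simp add: map_matrix_hom[OF unital_ring_hom_to_fract])
  show "stabilizes C P"
    using T(1) H unfolding stabilizes_def fract_quotients
    by (auto simp: invertible_return_difference[OF fract_inv] fract_loop)
  show "(THE H. fmat H = closed_loop P C) = vcat N D ** W ** hcat (- Nc) Dc"
  proof (rule the_equality)
    show "fmat (vcat N D ** W ** hcat (- Nc) Dc) = closed_loop P C" by (rule H)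
  next
    fix H
    assume "fmat H = closed_loop P C"
    then have "fmat H = fmat (vcat N D ** W ** hcat (- Nc) Dc)"
      by (simp only: H)
    then show "H = vcat N D ** W ** hcat (- Nc) Dc"
      by (simp only: map_matrix_inj[OF inj_to_fract])
  qed
qed

end

text \<open>Over the fractions both \<open>Dt ** N\<close> and \<open>Nt ** D\<close> equal
  \<open>Dt ** P ** D\<close>.\<close>

lemma left_right_coprime_annihilate:
  assumes rcf: "right_coprime_factorization P N D" and lcf: "left_coprime_factorization P Nt Dt"
  shows "hcat (- Dt) Nt ** vcat N D = 0"
proof -
  let ?F = "map_matrix to_fract"
  have "?F Dt ** P = ?F Nt"
    using lcf by (auto simp: left_coprime_factorization_def matrix_mul_assoc matrix_inv_works)
  moreover have "P ** ?F D = ?F N"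
    using rcf by (auto simp: right_coprime_factorization_def matrix_inv_works simp flip: matrix_mul_assoc)
  ultimately have "?F (Dt ** N) = ?F (Nt ** D)"
    by (metis map_matrix_mult matrix_mul_assoc unital_ring_hom_to_fract)
  then have "Dt ** N = Nt ** D" by (simp only: map_matrix_inj[OF inj_to_fract])
  then show ?thesis by (simp add: hcat_mult_vcat matrix_mult_minus_left)
qed

text \<open>The quotient of the denominators has entries in the ring by the Bezout identity, and so
  has its inverse by symmetry.\<close>

lemma right_coprime_factorization_unique:
  assumes 1: "right_coprime_factorization P N D" and 2: "right_coprime_factorization P N' D'"
  obtains U where "det U dvd 1" "vcat N' D' = vcat N D ** U"
proof -
  let ?F = "map_matrix to_fract"
  note h = map_matrix_hom[OF unital_ring_hom_to_fract]
  have *: "\<exists>U. N' = N ** U \<and> D' = D ** U"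
    if 1: "right_coprime_factorization P N D" and 2: "right_coprime_factorization P N' D'"
    for N D N' D'
  proof -
    have D: "invertible (?F D)" and P: "P = ?F N ** matrix_inv (?F D)"
      using 1 by (auto simp: right_coprime_factorization_def)
    have P': "P ** ?F D' = ?F N'"
      using 2 by (auto simp: right_coprime_factorization_def matrix_inv_works simp flip: matrix_mul_assoc)
    obtain X Y where XY: "X ** N + Y ** D = mat 1"
      using 1 by (auto simp: right_coprime_factorization_def)
    define V where "V = matrix_inv (?F D) ** ?F D'"
    \<comment> \<open>The Bezout combination of the new pair; it represents \<open>V\<close> over
      the ring.\<close>
    define U where "U = X ** N' + Y ** D'"
    have N': "?F N' = ?F N ** V" using P' by (simp add: P V_def matrix_mul_assoc)
    have D': "?F D' = ?F D ** V" by (simp add: V_def matrix_mul_assoc matrix_inv_works[OF D])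
    have "?F U = ?F (X ** N + Y ** D) ** V"
      by (simp add: U_def h N' D' matrix_mult_add_left matrix_mul_assoc)
    then have "V = ?F U" by (simp add: XY h)
    then have "?F N' = ?F (N ** U)" "?F D' = ?F (D ** U)" using N' D' by (simp_all add: h)
    then show ?thesis by (auto simp: map_matrix_inj[OF inj_to_fract])
  qed
  obtain U where U: "N' = N ** U" "D' = D ** U" using *[OF 1 2] by blast
  \<comment> \<open>Exchange the roles; cancelling \<open>D\<close> shows that \<open>U'\<close>
    inverts \<open>U\<close>.\<close>
  obtain U' where "D = D' ** U'" using *[OF 2 1] by blast
  then have "D = D ** (U ** U')" using U by (simp add: matrix_mul_assoc)
  then have "?F D = ?F D ** ?F (U ** U')" by (metis map_matrix_mult unital_ring_hom_to_fract)
  then have "matrix_inv (?F D) ** ?F D = matrix_inv (?F D) ** ?F D ** ?F (U ** U')"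
    by (metis matrix_mul_assoc)
  moreover have "invertible (?F D)" using 1 by (simp add: right_coprime_factorization_def)
  ultimately have "?F (U ** U') = ?F (mat 1)"
    by (simp add: matrix_inv_works h)
  then have "det U dvd 1" by (simp only: map_matrix_inj[OF inj_to_fract] det_dvd_one)
  then show ?thesis using that U by (simp add: vcat_mult)
qed

text \<open>The mirrored argument, with the quotient of denominators acting from the left.\<close>

lemma left_coprime_factorization_unique:
  assumes 1: "left_coprime_factorization P N D" and 2: "left_coprime_factorization P N' D'"
  obtains U where "hcat (- D') N' = U ** hcat (- D) N"
proof -
  let ?F = "map_matrix to_fract"
  note h = map_matrix_hom[OF unital_ring_hom_to_fract]
  have D: "invertible (?F D)" and P: "P = matrix_inv (?F D) ** ?F N"
    using 1 by (auto simp: left_coprime_factorization_def)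
  have P': "?F D' ** P = ?F N'"
    using 2 by (auto simp: left_coprime_factorization_def matrix_inv_works matrix_mul_assoc)
  obtain X Y where XY: "N ** X + D ** Y = mat 1"
    using 1 by (auto simp: left_coprime_factorization_def)
  define V where "V = ?F D' ** matrix_inv (?F D)"
  define U where "U = N' ** X + D' ** Y"
  have N': "?F N' = V ** ?F N" using P' by (simp add: P V_def matrix_mul_assoc)
  have D': "?F D' = V ** ?F D"
    by (simp add: V_def matrix_mul_assoc[symmetric] matrix_inv_works[OF D])
  have "?F U = V ** ?F (N ** X + D ** Y)"
    by (simp add: U_def h N' D' matrix_add_ldistrib matrix_mul_assoc)
  then have "V = ?F U" by (simp add: XY h)
  then have "?F N' = ?F (U ** N)" "?F D' = ?F (U ** D)" using N' D' by (simp_all add: h)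
  then show ?thesis
    using that by (simp add: map_matrix_inj[OF inj_to_fract] mult_hcat matrix_mult_minus_right)
qed

subsection \<open>The gap and the stability margin\<close>

locale indexed_algebra =
  fixes emb :: "'r::idom \<Rightarrow> 's::comm_complex_banach_algebra_1"
    and star :: "'s \<Rightarrow> 's"
    and \<iota> :: "'s \<Rightarrow> 'g::ab_group_add"
  assumes embedding: "ring_embedding emb"
    and symmetric: "symmetric_involution star"
    and index: "abstract_index star \<iota>"
    and unit_criterion: "\<And>x. emb x dvd 1 \<Longrightarrow> x dvd 1 \<longleftrightarrow> \<iota> (emb x) = 0"
begin

abbreviation "E \<equiv> map_matrix emb"

lemma hom_emb: "unital_ring_hom emb"
  using embedding by (simp add: ring_embedding_def unital_ring_hom_def)

lemma star_involution: "star (star x) = x"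
  using symmetric by (simp add: symmetric_involution_def involution_def)

lemma hom_star: "unital_ring_hom star"
proof -
  have inv: "star (x + y) = star x + star y" "star (x * y) = star x * star y" for x y
    using symmetric by (auto simp: symmetric_involution_def involution_def mult.commute)
  \<comment> \<open>That \<open>star\<close> fixes 1 follows from multiplicativity and
    involutivity.\<close>
  have "star (star 1) = star (star 1) * star 1"
    using inv(2)[of "star 1" 1] by (simp add: star_involution)
  then have "star 1 = 1" by (simp add: star_involution)
  then show ?thesis using inv by (simp add: unital_ring_hom_def)
qed

lemma index_mult: "a dvd 1 \<Longrightarrow> b dvd 1 \<Longrightarrow> \<iota> (a * b) = \<iota> a + \<iota> b"
  and index_star: "a dvd 1 \<Longrightarrow> \<iota> (star a) = - \<iota> a"
  using index by (auto simp: abstract_index_def)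

lemma index_emb_unit:
  assumes "x dvd 1"
  shows "emb x dvd 1" "\<iota> (emb x) = 0"
  using hom_unit[OF hom_emb assms] unit_criterion assms by auto

lemma character_star:
  "\<phi> \<in> maximal_ideal_space \<Longrightarrow> map_matrix \<phi> (mat_star star A) = mat_star cnj (map_matrix \<phi> A)"
  using symmetric by (intro map_matrix_mat_star) (auto simp: symmetric_involution_def)

lemmas character_hom = map_matrix_hom[OF unital_ring_hom_character]

lemma character_isometry:
  assumes "\<phi> \<in> maximal_ideal_space" "mat_star star A ** A = mat 1"
  shows "mat_star cnj (map_matrix \<phi> A) ** map_matrix \<phi> A = mat 1"
  using arg_cong[OF assms(2), of "map_matrix \<phi>"]
  by (simp add: character_hom[OF assms(1)] character_star[OF assms(1)])

lemma character_coisometry: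
  assumes "\<phi> \<in> maximal_ideal_space" "A ** mat_star star A = mat 1"
  shows "map_matrix \<phi> A ** mat_star cnj (map_matrix \<phi> A) = mat 1"
  using arg_cong[OF assms(2), of "map_matrix \<phi>"]
  by (simp add: character_hom[OF assms(1)] character_star[OF assms(1)])

section \<open>Normalized factorizations and independence of the metric from them\<close>

lemma normalized_rcf_isometry:
  "normalized_rcf emb star P N D \<Longrightarrow> mat_star star (E (vcat N D)) ** E (vcat N D) = mat 1"
  by (simp add: normalized_rcf_def map_matrix_vcat mat_star_vcat hcat_mult_vcat)

text \<open>The first form serves the plant, the second the controller.\<close>

lemma normalized_lcf_coisometry:
  assumes "normalized_lcf emb star P N D"
  shows "E (hcat (- D) N) ** mat_star star (E (hcat (- D) N)) = mat 1"
    and "E (hcat (- N) D) ** mat_star star (E (hcat (- N) D)) = mat 1"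
  using assms
  by (simp_all add: normalized_lcf_def map_matrix_hcat mat_star_hcat hcat_mult_vcat
      map_matrix_minus[OF hom_emb] mat_star_minus[OF hom_star] matrix_mult_minus_left
      matrix_mult_minus_right add.commute)

lemma normalized_rcf_unique:
  assumes 1: "normalized_rcf emb star P N D" and 2: "normalized_rcf emb star P N' D'"
  obtains U where "det U dvd 1" "vcat N' D' = vcat N D ** U" "mat_star star (E U) ** E U = mat 1"
proof -
  obtain U where U: "det U dvd 1" "vcat N' D' = vcat N D ** U"
    using right_coprime_factorization_unique 1 2 by (metis normalized_rcf_def)
  have "mat 1 = mat_star star (E (vcat N D ** U)) ** E (vcat N D ** U)"
    using normalized_rcf_isometry[OF 2] by (simp only: U)
  also have "\<dots> = mat_star star (E U) ** (mat_star star (E (vcat N D)) ** E (vcat N D)) ** E U"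
    by (simp only: map_matrix_mult[OF hom_emb] mat_star_mult[OF hom_star] matrix_mul_assoc)
  finally show ?thesis using that U by (simp add: normalized_rcf_isometry[OF 1])
qed

lemma normalized_lcf_unique:
  assumes 1: "normalized_lcf emb star P N D" and 2: "normalized_lcf emb star P N' D'"
  obtains U where "hcat (- D') N' = U ** hcat (- D) N" "E U ** mat_star star (E U) = mat 1"
proof -
  obtain U where U: "hcat (- D') N' = U ** hcat (- D) N"
    using left_coprime_factorization_unique 1 2 by (metis normalized_lcf_def)
  let ?G = "hcat (- D) N"
  have "mat 1 = E (U ** ?G) ** mat_star star (E (U ** ?G))"
    using normalized_lcf_coisometry(1)[OF 2] by (simp only: U)
  also have "\<dots> = E U ** (E ?G ** mat_star star (E ?G)) ** mat_star star (E U)"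
    by (simp only: map_matrix_mult[OF hom_emb] mat_star_mult[OF hom_star] matrix_mul_assoc)
  finally show ?thesis using that U by (simp add: normalized_lcf_coisometry(1)[OF 1])
qed

text \<open>Changing factorizations multiplies by ring units, which have index 0, and by matrices
  that no character lets increase the norm. One direction suffices, as the two families can be
  exchanged.\<close>

lemma d_nu_independent:
  assumes f1: "normalized_rcf emb star P1 N1 D1" "normalized_rcf emb star P1 N1' D1'"
    and f2: "normalized_rcf emb star P2 N2 D2" "normalized_rcf emb star P2 N2' D2'"
    and l2: "normalized_lcf emb star P2 Nt2 Dt2" "normalized_lcf emb star P2 Nt2' Dt2'"
  defines "c \<equiv> det (mat_star star (E (vcat N1 D1)) ** E (vcat N2 D2))"
    and "c' \<equiv> det (mat_star star (E (vcat N1' D1')) ** E (vcat N2' D2'))"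
  shows "c dvd 1 \<Longrightarrow> \<iota> c = 0 \<Longrightarrow> c' dvd 1 \<and> \<iota> c' = 0"
    and "gelfand_norm (E (hcat (- Dt2') Nt2') ** E (vcat N1' D1'))
      \<le> gelfand_norm (E (hcat (- Dt2) Nt2) ** E (vcat N1 D1))"
proof -
  obtain U1 where U1: "det U1 dvd 1" "vcat N1' D1' = vcat N1 D1 ** U1" "mat_star star (E U1) ** E U1 = mat 1"
    using normalized_rcf_unique[OF f1] .
  obtain U2 where U2: "det U2 dvd 1" "vcat N2' D2' = vcat N2 D2 ** U2"
    using normalized_rcf_unique[OF f2] .
  have "c' = det (mat_star star (E U1) ** (mat_star star (E (vcat N1 D1)) ** E (vcat N2 D2)) ** E U2)"
    unfolding c'_def U1 U2
    by (simp only: map_matrix_mult[OF hom_emb] mat_star_mult[OF hom_star] matrix_mul_assoc)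
  then have c': "c' = star (emb (det U1)) * c * emb (det U2)"
    by (simp only: det_mul c_def det_mat_star[OF hom_star] det_map_matrix[OF hom_emb])
  assume "c dvd 1" "\<iota> c = 0"
  moreover have "star (emb (det U1)) dvd 1" "\<iota> (star (emb (det U1))) = 0"
    using index_emb_unit[OF U1(1)] by (simp_all add: index_star hom_unit[OF hom_star])
  moreover note index_emb_unit[OF U2(1)]
  ultimately show "c' dvd 1 \<and> \<iota> c' = 0"
    unfolding c' by (simp add: index_mult unit_mult)
next
  obtain U1 where U1: "vcat N1' D1' = vcat N1 D1 ** U1" "mat_star star (E U1) ** E U1 = mat 1"
    using normalized_rcf_unique[OF f1] .
  obtain V where V: "hcat (- Dt2') Nt2' = V ** hcat (- Dt2) Nt2" "E V ** mat_star star (E V) = mat 1"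
    using normalized_lcf_unique[OF l2] .
  let ?M = "E (hcat (- Dt2) Nt2) ** E (vcat N1 D1)"
  have eq: "E (hcat (- Dt2') Nt2') ** E (vcat N1' D1') = E V ** ?M ** E U1"
    unfolding U1 V by (simp only: map_matrix_mult[OF hom_emb] matrix_mul_assoc)
  show "gelfand_norm (E (hcat (- Dt2') Nt2') ** E (vcat N1' D1')) \<le> gelfand_norm ?M"
    unfolding eq
  proof (rule gelfand_norm_le[OF gelfand_norm_nonneg])
    fix \<phi> :: "'s \<Rightarrow> complex" and v
    assume \<phi>: "\<phi> \<in> maximal_ideal_space"
    have "map_matrix \<phi> (E V ** ?M ** E U1) *v v
        = map_matrix \<phi> (E V) *v (map_matrix \<phi> ?M *v (map_matrix \<phi> (E U1) *v v))"
      by (simp only: map_matrix_mult[OF unital_ring_hom_character[OF \<phi>]] matrix_vector_mul_assoc matrix_mul_assoc)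
    also have "norm \<dots> \<le> norm (map_matrix \<phi> ?M *v (map_matrix \<phi> (E U1) *v v))"
      by (intro norm_coisometry_le character_coisometry \<phi> V)
    also have "\<dots> \<le> gelfand_norm ?M * norm (map_matrix \<phi> (E U1) *v v)"
      by (rule norm_le_gelfand_norm[OF \<phi>])
    also have "norm (map_matrix \<phi> (E U1) *v v) = norm v"
      by (intro norm_isometry character_isometry \<phi> U1)
    finally show "norm (map_matrix \<phi> (E V ** ?M ** E U1) *v v) \<le> gelfand_norm ?M * norm v" .
  qed
qed

lemma d_nu_eq:
  assumes f1: "normalized_rcf emb star P1 N1 D1" and f2: "normalized_rcf emb star P2 N2 D2"
    and l2: "normalized_lcf emb star P2 Nt2 Dt2"
  shows "d_nu emb star \<iota> P1 P2 =
    d_nu_value star \<iota> (E (vcat N1 D1)) (E (vcat N2 D2)) (E (hcat (- Dt2) Nt2))"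
proof -
  have "d_nu_value star \<iota> (E (vcat N1' D1')) (E (vcat N2' D2')) (E (hcat (- Dt2') Nt2'))
      = d_nu_value star \<iota> (E (vcat N1 D1)) (E (vcat N2 D2)) (E (hcat (- Dt2) Nt2))"
    if f1': "normalized_rcf emb star P1 N1' D1'" and f2': "normalized_rcf emb star P2 N2' D2'"
      and l2': "normalized_lcf emb star P2 Nt2' Dt2'" for N1' D1' N2' D2' Nt2' Dt2'
    using d_nu_independent[OF f1 f1' f2 f2' l2 l2'] d_nu_independent[OF f1' f1 f2' f2 l2' l2]
    unfolding d_nu_value_def by (auto intro: antisym)
  then show ?thesis
    unfolding d_nu_def using assms by (intro the_equality) blast+
qed

text \<open>In the stable case the closed loop fixes the range of \<open>G\<close>, so its norm is
  at least 1 and the margin lies in \<open>(0, 1]\<close>.\<close>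

lemma stability_margin_cases:
  fixes N :: "'r^'m^'p"
  assumes P: "normalized_rcf emb star P N D" and C: "normalized_lcf emb star C Nc Dc"
  defines "G \<equiv> vcat N D" and "K \<equiv> hcat (- Nc) Dc"
  obtains (unstable) "\<not> stabilizes C P" "stability_margin emb P C = 0"
  | (stable) W where "(K ** G) ** W = mat 1" "W ** (K ** G) = mat 1"
      "stability_margin emb P C = inverse (gelfand_norm (E (G ** W ** K)))"
      "gelfand_norm (E (G ** W ** K)) \<ge> 1"
proof (cases "stabilizes C P")
  case False
  then show ?thesis by (intro unstable) (auto simp: stability_margin_def)
next
  case True
  have fac: "right_coprime_factorization P N D" "left_coprime_factorization C Nc Dc"
    using P C by (auto simp: normalized_rcf_def normalized_lcf_def)
  obtain W where W: "(K ** G) ** W = mat 1" "W ** (K ** G) = mat 1"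
    using matrix_inverse_of_unit_det[OF stabilizes_imp_unit_det[OF fac True]]
    unfolding G_def K_def by blast
  define H where "H = G ** W ** K"
  have "stability_margin emb P C = inverse (gelfand_norm (E H))"
    using True closed_loop_over_ring[OF fac W(1)[unfolded G_def K_def]]
    by (simp add: stability_margin_def H_def G_def K_def)
  moreover have "gelfand_norm (E H) \<ge> 1"
  proof -
    obtain \<phi> :: "'s \<Rightarrow> complex" where \<phi>: "\<phi> \<in> maximal_ideal_space"
      using maximal_ideal_space_nonempty by blast
    have "H ** G = G ** (W ** (K ** G))" by (simp add: H_def matrix_mul_assoc)
    then have HG: "H ** G = G" by (simp add: W)
    \<comment> \<open>Any unit vector in the range of \<open>G\<close> would do.\<close>
    define u where "u = map_matrix \<phi> (E G) *v axis undefined 1"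
    have "norm u = norm (axis undefined (1::complex) :: complex^'m)"
      unfolding u_def G_def by (intro norm_isometry character_isometry[OF \<phi>] normalized_rcf_isometry[OF P])
    then have "norm u = 1" by (simp add: norm_eq_sqrt_inner inner_axis_axis)
    have "map_matrix \<phi> (E H) *v u = map_matrix \<phi> (E (H ** G)) *v axis undefined 1"
      by (simp only: u_def matrix_vector_mul_assoc map_matrix_mult[OF hom_emb]
          map_matrix_mult[OF unital_ring_hom_character[OF \<phi>]])
    then have "map_matrix \<phi> (E H) *v u = u" by (simp only: HG u_def)
    then show ?thesis using norm_le_gelfand_norm[OF \<phi>, of "E H" u] \<open>norm u = 1\<close> by simp
  qed
  ultimately show ?thesis using W by (intro stable) (simp_all add: H_def)
qed

lemma stability_margin_bounds:
  assumes "normalized_rcf emb star P N D" "normalized_lcf emb star C Nc Dc"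
  shows "0 \<le> stability_margin emb P C" "stability_margin emb P C \<le> 1"
  by (rule stability_margin_cases[OF assms]; simp add: inverse_le_1_iff)+

lemma robust_stability_margin:
  fixes P0 P1 :: "'r fract^'m^'p" and C :: "'r fract^'p^'m"
  assumes P0: "normalized_rcf emb star P0 N0 D0"
    and P1: "normalized_rcf emb star P1 N1 D1" "normalized_lcf emb star P1 Nt1 Dt1"
    and C: "normalized_lcf emb star C Nc Dc"
  shows "arcsin (stability_margin emb P1 C) \<ge>
    arcsin (stability_margin emb P0 C) - arcsin (d_nu emb star \<iota> P0 P1)"
proof -
  define G0 G1 Gt1 K where "G0 = vcat N0 D0" and "G1 = vcat N1 D1" and "Gt1 = hcat (- Dt1) Nt1"
    and "K = hcat (- Nc) Dc"
  define \<mu>0 \<mu>1 d where "\<mu>0 = stability_margin emb P0 C" and "\<mu>1 = stability_margin emb P1 C"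
    and "d = d_nu emb star \<iota> P0 P1"
  have G0: "mat_star star (E G0) ** E G0 = mat 1" and G1: "mat_star star (E G1) ** E G1 = mat 1"
    and Gt1: "E Gt1 ** mat_star star (E Gt1) = mat 1" and K: "E K ** mat_star star (E K) = mat 1"
    unfolding G0_def G1_def Gt1_def K_def
    by (rule normalized_rcf_isometry normalized_lcf_coisometry assms)+
  have fac1: "right_coprime_factorization P1 N1 D1" "left_coprime_factorization C Nc Dc"
    using P1 C by (auto simp: normalized_rcf_def normalized_lcf_def)
  have "Gt1 ** G1 = 0"
    unfolding Gt1_def G1_def
    using P1 by (intro left_right_coprime_annihilate) (auto simp: normalized_rcf_def normalized_lcf_def)
  then have ann: "E Gt1 ** E G1 = 0"
    by (metis hom_emb map_matrix_mult map_matrix_zero)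
  have \<mu>0: "0 \<le> \<mu>0" "\<mu>0 \<le> 1" and \<mu>1: "0 \<le> \<mu>1" "\<mu>1 \<le> 1"
    unfolding \<mu>0_def \<mu>1_def by (rule stability_margin_bounds[OF P0 C] stability_margin_bounds[OF P1(1) C])+
  let ?\<delta> = "det (mat_star star (E G0) ** E G1)"
  have d_eq: "d = (if ?\<delta> dvd 1 \<and> \<iota> ?\<delta> = 0 then gelfand_norm (E Gt1 ** E G0) else 1)"
    unfolding d_def d_nu_eq[OF P0 P1] by (simp add: d_nu_value_def G0_def G1_def Gt1_def)
  \<comment> \<open>A coisometry after an isometry; this keeps \<open>d\<close> in the domain of the
    arcsine.\<close>
  have "gelfand_norm (E Gt1 ** E G0) \<le> 1"
  proof (rule gelfand_norm_le)
    fix \<phi> :: "'s \<Rightarrow> complex" and v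
    assume \<phi>: "\<phi> \<in> maximal_ideal_space"
    have "norm (map_matrix \<phi> (E Gt1) *v (map_matrix \<phi> (E G0) *v v)) \<le> norm (map_matrix \<phi> (E G0) *v v)"
      by (intro norm_coisometry_le character_coisometry \<phi> Gt1)
    also have "\<dots> = norm v" by (intro norm_isometry character_isometry \<phi> G0)
    finally show "norm (map_matrix \<phi> (E Gt1 ** E G0) *v v) \<le> 1 * norm v"
      by (simp add: matrix_vector_mul_assoc map_matrix_mult[OF unital_ring_hom_character[OF \<phi>]])
  qed simp
  then have d: "0 \<le> d" "d \<le> 1" using d_eq gelfand_norm_nonneg by (auto split: if_splits)
  show ?thesis
  proof (cases "d < \<mu>0")
    case False
    \<comment> \<open>The claimed lower bound is not positive here, whereas the margin is
      nonnegative.\<close>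
    then have "arcsin \<mu>0 \<le> arcsin d" using \<mu>0 d by (intro arcsin_le_arcsin) auto
    moreover have "0 \<le> arcsin \<mu>1" using arcsin_le_arcsin[of 0 \<mu>1] \<mu>1 by simp
    ultimately show ?thesis by (simp add: \<mu>0_def \<mu>1_def d_def)
  next
    case True
    \<comment> \<open>These strict bounds exclude the default values 1 of the metric and 0 of the
      margin.\<close>
    then have "d < 1" "\<mu>0 > 0" using \<mu>0 d by auto
    then have \<delta>: "?\<delta> dvd 1" "\<iota> ?\<delta> = 0" and d': "d = gelfand_norm (E Gt1 ** E G0)"
      using d_eq by (auto split: if_splits)
    obtain W0 where W0: "(K ** G0) ** W0 = mat 1" "W0 ** (K ** G0) = mat 1"
      and m0: "\<mu>0 = inverse (gelfand_norm (E (G0 ** W0 ** K)))" "gelfand_norm (E (G0 ** W0 ** K)) \<ge> 1"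
      using \<open>\<mu>0 > 0\<close> unfolding G0_def K_def \<mu>0_def by (rule_tac stability_margin_cases[OF P0 C]) auto
    \<comment> \<open>The closed loop maps \<open>?x\<close> to \<open>G0 *v u\<close>, whose norm
      is \<open>norm u\<close>, and \<open>?x\<close> is as long as \<open>?z\<close>; so its norm
      bounds \<open>norm u\<close> in terms of \<open>norm ?z\<close>.\<close>
    have margin: "\<mu>0 * norm u \<le> norm ((map_matrix \<phi> (E K) ** map_matrix \<phi> (E G0)) *v u)"
      if \<phi>: "\<phi> \<in> maximal_ideal_space" for \<phi> u
    proof -
      let ?H = "E (G0 ** W0 ** K)"
      let ?z = "(map_matrix \<phi> (E K) ** map_matrix \<phi> (E G0)) *v u"
      let ?x = "mat_star cnj (map_matrix \<phi> (E K)) *v ?z"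
      have "norm ?x = norm ?z"
        using character_coisometry[OF \<phi> K] by (intro norm_isometry) (simp add: mat_star_mat_star)
      have "map_matrix \<phi> ?H *v ?x =
          (map_matrix \<phi> (E (G0 ** W0)) ** (map_matrix \<phi> (E K) ** mat_star cnj (map_matrix \<phi> (E K))) **
            map_matrix \<phi> (E (K ** G0))) *v u"
        by (simp only: map_matrix_mult[OF hom_emb] matrix_vector_mul_assoc matrix_mul_assoc
            map_matrix_mult[OF unital_ring_hom_character[OF \<phi>]])
      also have "\<dots> = map_matrix \<phi> (E (G0 ** (W0 ** (K ** G0)))) *v u"
        by (simp only: character_coisometry[OF \<phi> K] matrix_mul_rid map_matrix_mult[OF hom_emb]
            map_matrix_mult[OF unital_ring_hom_character[OF \<phi>]] matrix_mul_assoc)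
      also have "norm \<dots> = norm u"
        unfolding W0 matrix_mul_rid by (intro norm_isometry character_isometry \<phi> G0)
      finally have "norm u \<le> gelfand_norm ?H * norm ?z"
        using norm_le_gelfand_norm[OF \<phi>, of ?H ?x] \<open>norm ?x = norm ?z\<close> by simp
      then have "inverse (gelfand_norm ?H) * norm u \<le> inverse (gelfand_norm ?H) * (gelfand_norm ?H * norm ?z)"
        using m0(2) by (intro mult_left_mono) auto
      also have "\<dots> = norm ?z" using m0(2) by simp
      finally show ?thesis unfolding m0(1) .
    qed
    have gap: "norm ((map_matrix \<phi> (E Gt1) ** map_matrix \<phi> (E G0)) *v u) \<le> d * norm u"
      if \<phi>: "\<phi> \<in> maximal_ideal_space" for \<phi> u
      using norm_le_gelfand_norm[OF \<phi>, of "E Gt1 ** E G0" u]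
      by (simp add: d' map_matrix_mult[OF unital_ring_hom_character[OF \<phi>]])
    \<comment> \<open>The ends of the homotopy: \<open>X\<close> has known index, and
      \<open>Y\<close> contains \<open>K G1\<close> times a factor whose determinant is
      \<open>star\<close> of \<open>?\<delta>\<close>.\<close>
    define X Y where "X = E K ** E G0" and "Y = (E K ** E G1) ** (mat_star star (E G1) ** E G0)"
    define B where "B t = (1 - t) *\<^sub>R X + t *\<^sub>R Y" for t :: real
    have unit: "det (B t) dvd 1" if t: "t \<in> {0..1}" for t
      unfolding unit_iff_characters
    proof
      fix \<phi> :: "'s \<Rightarrow> complex" assume \<phi>: "\<phi> \<in> maximal_ideal_space"
      let ?m = "map_matrix \<phi>"
      have "\<phi> (r *\<^sub>R x) = r *\<^sub>R \<phi> x" for r x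
      proof -
        have "\<phi> (scaleC (of_real r) x) = of_real r * \<phi> x"
          using \<phi> by (simp add: maximal_ideal_space_def)
        then show ?thesis by (simp only: scaleC_of_real scaleR_conv_of_real)
      qed
      then have mB: "?m (B t) = (1 - t) *\<^sub>R ?m X + t *\<^sub>R ?m Y"
        by (simp add: B_def vec_eq_iff hom_add[OF unital_ring_hom_character[OF \<phi>]])
      have B: "?m (B t) *v u = ?m X *v u - t *\<^sub>R (?m X *v u - ?m Y *v u)" for u
        unfolding mB by (simp add: matrix_vector_mult_add_rdistrib scaleR_matrix_vector_mult algebra_simps)
      \<comment> \<open>The difference passes through the component of \<open>G0 *v u\<close>
        orthogonal to the range of \<open>G1\<close>, which the gap controls.\<close>
      have XY: "?m X *v u - ?m Y *v u =
          ?m (E K) *v (?m (E G0) *v u - ?m (E G1) *v (mat_star cnj (?m (E G1)) *v (?m (E G0) *v u)))" for u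
        by (simp add: X_def Y_def matrix_vector_mult_diff_distrib matrix_vector_mul_assoc
            character_hom[OF \<phi>] character_star[OF \<phi>] matrix_mul_assoc)
      have "u = 0" if "?m (B t) *v u = 0" for u
      proof (rule ccontr)
        assume "u \<noteq> 0"
        have "norm (?m X *v u - ?m Y *v u) \<le>
            norm (?m (E G0) *v u - ?m (E G1) *v (mat_star cnj (?m (E G1)) *v (?m (E G0) *v u)))"
          unfolding XY by (intro norm_coisometry_le character_coisometry \<phi> K)
        also have "\<dots> = norm (?m (E Gt1) *v (?m (E G0) *v u))"
          using arg_cong[OF ann, of ?m]
          by (intro isometry_complement_norm(2) character_isometry character_coisometry \<phi> G1 Gt1)
             (simp add: character_hom[OF \<phi>])
        also have "\<dots> \<le> d * norm u" using gap[OF \<phi>, of u] by (simp add: matrix_vector_mul_assoc)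
        finally have le: "norm (?m X *v u - ?m Y *v u) \<le> d * norm u" .
        \<comment> \<open>A kernel vector would make \<open>?m X *v u\<close> shorter than the
          margin allows, since \<open>d < \<mu>0\<close>.\<close>
        have "?m X *v u = t *\<^sub>R (?m X *v u - ?m Y *v u)" using that B[of u] by simp
        then have "norm (?m X *v u) = t * norm (?m X *v u - ?m Y *v u)"
          using t by (metis abs_of_nonneg atLeastAtMost_iff norm_scaleR)
        also have "\<dots> \<le> 1 * (d * norm u)" using t le d by (intro mult_mono) auto
        also have "\<dots> < \<mu>0 * norm u" using True \<open>u \<noteq> 0\<close> by simp
        finally show False
          using margin[OF \<phi>, of u] by (simp add: X_def character_hom[OF \<phi>])
      qed
      then have "det (?m (B t)) \<noteq> 0"
        by (metis invertible_det_nz invertible_left_inverse matrix_left_invertible_ker)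
      then show "\<phi> (det (B t)) \<noteq> 0"
        by (simp add: det_map_matrix[OF unital_ring_hom_character[OF \<phi>]])
    qed
    have "\<iota> (det (B 0)) = \<iota> (det (B 1))"
      by (intro abstract_index_path[OF index] continuous_on_det unit)
         (auto simp: B_def intro!: continuous_intros)
    then have \<iota>_eq: "\<iota> (det X) = \<iota> (det Y)" by (simp add: B_def)
    \<comment> \<open>Stability of the first loop is invertibility over the ring, so the index is 0
      at the start of the segment.\<close>
    have "det (K ** G0) dvd 1" using W0(1) by (rule det_dvd_one)
    moreover have "det X = emb (det (K ** G0))"
      by (simp add: X_def map_matrix_mult[OF hom_emb] flip: det_map_matrix[OF hom_emb])
    ultimately have "\<iota> (det X) = 0" by (simp add: index_emb_unit)
    define e where "e = emb (det (K ** G1))"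
    have e: "e = det (E K ** E G1)"
      by (simp add: e_def map_matrix_mult[OF hom_emb] flip: det_map_matrix[OF hom_emb])
    have "mat_star star (E G1) ** E G0 = mat_star star (mat_star star (E G0) ** E G1)"
      by (simp add: mat_star_mult[OF hom_star] mat_star_mat_star star_involution)
    then have "det (mat_star star (E G1) ** E G0) = star ?\<delta>"
      by (simp only: det_mat_star[OF hom_star])
    then have Y: "det Y = e * star ?\<delta>" by (simp add: Y_def det_mul e)
    have "det Y dvd 1" using unit[of 1] by (simp add: B_def)
    then have "e dvd 1" unfolding Y by (rule dvd_mult_left)
    moreover have "star ?\<delta> dvd 1" "\<iota> (star ?\<delta>) = 0"
      using \<delta> by (simp_all add: index_star hom_unit[OF hom_star])
    ultimately have "\<iota> e = 0"
      using \<iota>_eq \<open>\<iota> (det X) = 0\<close> by (simp add: Y index_mult)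
    \<comment> \<open>The index criterion turns invertibility over the algebra into invertibility
      over the ring.\<close>
    then have "det (K ** G1) dvd 1"
      using unit_criterion \<open>e dvd 1\<close> unfolding e_def by blast
    then obtain W1 where W1: "(K ** G1) ** W1 = mat 1"
      using matrix_inverse_of_unit_det by blast
    have "stabilizes C P1"
      using stabilizes_if_inverse[OF fac1] W1 unfolding K_def G1_def by blast
    let ?H = "E (G1 ** W1 ** K)"
    have \<mu>1_eq: "\<mu>1 = inverse (gelfand_norm ?H)"
      using \<open>stabilizes C P1\<close> closed_loop_over_ring[OF fac1, of W1] W1
      by (simp add: \<mu>1_def stability_margin_def K_def G1_def)
    \<comment> \<open>Guards against \<open>inverse 0 = 0\<close>; the stable case supplies a norm
      of at least 1.\<close>
    have "gelfand_norm ?H \<noteq> 0"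
    proof (rule stability_margin_cases[OF P1(1) C])
      assume "\<not> stabilizes C P1" then show ?thesis using \<open>stabilizes C P1\<close> by simp
    next
      fix W assume "stability_margin emb P1 C = inverse (gelfand_norm (E (vcat N1 D1 ** W ** hcat (- Nc) Dc)))"
        "1 \<le> gelfand_norm (E (vcat N1 D1 ** W ** hcat (- Nc) Dc))"
      then show ?thesis using \<mu>1_eq by (auto simp: \<mu>1_def)
    qed
    then have pos: "gelfand_norm ?H > 0" using gelfand_norm_nonneg[of ?H] by linarith
    define s where "s = sin (arcsin \<mu>0 - arcsin d)"
    have bd: "0 \<le> arcsin d" "arcsin \<mu>0 \<le> pi / 2" "arcsin d < arcsin \<mu>0"
      using arcsin_le_arcsin[of 0 d] arcsin_bounded[of \<mu>0] arcsin_less_arcsin[of d \<mu>0] d \<mu>0 True by auto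
    then have "s > 0" unfolding s_def by (intro sin_gt_zero) (use pi_gt_zero in linarith)+
    have "gelfand_norm ?H \<le> 1 / s"
    proof (rule gelfand_norm_le)
      fix \<phi> :: "'s \<Rightarrow> complex" and x
      assume \<phi>: "\<phi> \<in> maximal_ideal_space"
      let ?m = "\<lambda>A. map_matrix \<phi> (E A)"
      \<comment> \<open>The closed loop sends \<open>x\<close> to \<open>G1 y\<close>, where
        \<open>K G1 y = K x\<close>; the lower bound on \<open>K G1\<close> thus bounds
        \<open>y\<close>.\<close>
      define y where "y = ?m W1 *v (?m K *v x)"
      have Hx: "?m (G1 ** W1 ** K) *v x = ?m G1 *v y"
        by (simp add: y_def map_matrix_mult[OF hom_emb] character_hom[OF \<phi>] matrix_vector_mul_assoc matrix_mul_assoc)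
      have "(?m K ** ?m G1) *v y = ?m ((K ** G1) ** W1) *v (?m K *v x)"
        by (simp add: y_def map_matrix_mult[OF hom_emb] character_hom[OF \<phi>] matrix_vector_mul_assoc matrix_mul_assoc)
      then have Ky: "(?m K ** ?m G1) *v y = ?m K *v x"
        by (simp add: W1 map_matrix_one[OF hom_emb] character_hom[OF \<phi>])
      have "\<phi> ?\<delta> \<noteq> 0" using \<delta> \<phi> by (simp add: unit_iff_characters)
      then have det: "det (mat_star cnj (?m G0) ** ?m G1) \<noteq> 0"
        by (simp add: character_hom[OF \<phi>] character_star[OF \<phi>]
            flip: det_map_matrix[OF unital_ring_hom_character[OF \<phi>]])
      have "s * norm y \<le> norm ((?m K ** ?m G1) *v y)"
        unfolding s_def
        by (rule robust_lower_bound[OF character_isometry[OF \<phi> G0] character_isometry[OF \<phi> G1]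
              character_coisometry[OF \<phi> Gt1] _ character_coisometry[OF \<phi> K] det gap[OF \<phi>] d margin[OF \<phi>] \<mu>0(1)])
           (use arg_cong[OF ann, of "map_matrix \<phi>"] in \<open>simp add: character_hom[OF \<phi>]\<close>)
      also have "\<dots> \<le> norm x"
        unfolding Ky by (intro norm_coisometry_le character_coisometry \<phi> K)
      finally have "norm y \<le> 1 / s * norm x" using \<open>s > 0\<close> by (simp add: field_simps)
      moreover have "norm (?m G1 *v y) = norm y"
        by (intro norm_isometry character_isometry \<phi> G1)
      ultimately show "norm (map_matrix \<phi> ?H *v x) \<le> 1 / s * norm x" by (simp add: Hx)
    qed (use \<open>s > 0\<close> in simp)
    then have "s \<le> \<mu>1" using pos \<open>s > 0\<close> by (simp add: \<mu>1_eq field_simps)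
    then have "arcsin s \<le> arcsin \<mu>1" using \<open>s > 0\<close> \<mu>1 by (intro arcsin_le_arcsin) auto
    \<comment> \<open>The difference of angles lies between 0 and \<open>pi / 2\<close>, where the
      arcsine inverts the sine.\<close>
    moreover have "arcsin s = arcsin \<mu>0 - arcsin d"
      unfolding s_def using bd by (intro arcsin_sin) auto
    ultimately show ?thesis by (simp add: \<mu>0_def \<mu>1_def d_def)
  qed
qed

end

theorem theorem4p6:
  fixes emb :: "'r::idom \<Rightarrow> 's::comm_complex_banach_algebra_1"
    and star :: "'s \<Rightarrow> 's"
    and \<iota> :: "'s \<Rightarrow> 'g::ab_group_add"
    and P\<^sub>0 P\<^sub>1 :: "'r fract^'m^'p"
    and C :: "'r fract^'p^'m"
  assumes "ring_embedding emb"
    and "(jacobson_radical :: 's set) = {0}"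
    and "symmetric_involution star"
    and "abstract_index star \<iota>"
    and "\<And>x. emb x dvd 1 \<Longrightarrow> x dvd 1 \<longleftrightarrow> \<iota> (emb x) = 0"
    and "P\<^sub>0 \<in> normalized_plants emb star"
    and "P\<^sub>1 \<in> normalized_plants emb star"
    and "C \<in> normalized_plants emb star"
  shows "arcsin (stability_margin emb P\<^sub>1 C) \<ge>
    arcsin (stability_margin emb P\<^sub>0 C) - arcsin (d_nu emb star \<iota> P\<^sub>0 P\<^sub>1)"
proof -
  interpret indexed_algebra emb star \<iota>
    using assms by unfold_locales
  show ?thesis
    using assms(6-8) robust_stability_margin unfolding normalized_plants_def by blast
qed

end
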